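(* Let $X$ be a curve over a finite field, $P,Q$ distinct rational points, and $A,C$ divisors. Then \[ A\in\Delta_P(C+Q)\iff A_P\leq A\leq (A-C)_P+C . \] Moreover, (i) $A_P=A$ and $A\leq(A-C)_P+C$ if and only if $A\in\Delta_P(C+Q)$ and $A-Q\notin\Delta_P(C+Q)$; (ii) $A_P\leq A$ and $A=(A-C)_P+C$ if and only if $A\in\Delta_P(C+Q)$ and $A+Q\notin\Delta_P(C+Q)$, if and only if $A\in\Delta_P(C+Q)$ and $A\notin\Delta_P(C)$.
   Context: $L(E)=\{f:(f)+E\ge0\}\cup\{0\}$. $\Gamma_P=\{A: L(A)\ne L(A-P)\}$; $\Delta_P(C)=\{A\in\Gamma_P : A-C\notin\Gamma_P\}$. For a divisor $E$, $E_P$ denotes the divisor $E+kQ$ where $k\in\mathbb{Z}$ is minimal such that $L(E+kQ)\neq L(E+kQ-P)$; equivalently, $E_P$ is the unique divisor of the form $E+kQ$ lying in $\Delta_Q(P)$. Since $A_P$, $A$, $(A-C)_P+C$ differ only by multiples of $Q$, the inequalities compare their multiplicities at $Q$. *)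

theory Defs
  imports
    "HOL-Algebra.Algebraic_Closure_Type"
    "HOL-Algebra.Finite_Extensions"
    "HOL-Algebra.Generated_Fields"
    "HOL-Algebra.Free_Abelian_Groups"
begin

text \<open>
  A smooth projective absolutely irreducible curve \<open>X\<close> over a finite field \<open>K\<close> is given as the
  abstract complete nonsingular curve of its function field: the type \<open>'f\<close> is the function field
  \<open>K(X)\<close>, the constants \<open>K\<close> are a subset of it, and the closed points of \<open>X\<close> are the normalized
  discrete valuations of \<open>'f\<close> that are trivial on \<open>K\<close>.
  Absolute irreducibility is the last conjunct (\<open>K\<close> is perfect and algebraically closed in \<open>'f\<close>);
  it holds automatically as soon as \<open>X\<close> has a rational point.
\<close>

definition curve_over_finite_field :: "'f::field set \<Rightarrow> bool" where
  "curve_over_finite_field K \<longleftrightarrow>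
     (let F = (ring_of_type_algebra :: 'f ring) in
        subfield K F \<and> finite K \<and>
        (\<exists>x. ring.transcendental F K x \<and>
             ring.finite_dimension F (generate_field F (insert x K)) UNIV) \<and>
        (\<forall>x. \<not> ring.transcendental F K x \<longrightarrow> x \<in> K))"

text \<open>
  The value \<open>v 0 = 0\<close> is a dummy replacing \<open>\<infinity>\<close>; fixing it makes a point determine its
  valuation function uniquely.
\<close>

definition closed_points :: "'f::field set \<Rightarrow> ('f \<Rightarrow> int) set" where
  "closed_points K = {v.
     v 0 = 0 \<and>
     (\<forall>f g. f \<noteq> 0 \<and> g \<noteq> 0 \<longrightarrow> v (f * g) = v f + v g) \<and>
     (\<forall>f g. f \<noteq> 0 \<and> g \<noteq> 0 \<and> f + g \<noteq> 0 \<longrightarrow> min (v f) (v g) \<le> v (f + g)) \<and>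
     (\<forall>c\<in>K. c \<noteq> 0 \<longrightarrow> v c = 0) \<and>
     (\<exists>t. t \<noteq> 0 \<and> v t = 1)}"

definition local_ring :: "('f::field \<Rightarrow> int) \<Rightarrow> 'f set" where
  "local_ring v = {f. f = 0 \<or> 0 \<le> v f}"

definition local_max_ideal :: "('f::field \<Rightarrow> int) \<Rightarrow> 'f set" where
  "local_max_ideal v = {f. f = 0 \<or> 0 < v f}"

text \<open>A point is rational if \<open>K\<close> maps onto its residue field.\<close>

definition rational_points :: "'f::field set \<Rightarrow> ('f \<Rightarrow> int) set" where
  "rational_points K =
     {v \<in> closed_points K. \<forall>f\<in>local_ring v. \<exists>c\<in>K. f - c \<in> local_max_ideal v}"

type_synonym 'f divisor = "('f \<Rightarrow> int) \<Rightarrow>\<^sub>0 int"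

definition divisors :: "'f::field set \<Rightarrow> 'f divisor set" where
  "divisors K = carrier (free_Abelian_group (closed_points K))"

text \<open>The coefficientwise order; the library order on \<open>\<Rightarrow>\<^sub>0\<close> is lexicographic.\<close>

definition div_le :: "'f divisor \<Rightarrow> 'f divisor \<Rightarrow> bool" (infix \<open>\<le>\<^sub>D\<close> 50) where
  "A \<le>\<^sub>D B \<longleftrightarrow> (\<forall>v. Poly_Mapping.lookup A v \<le> Poly_Mapping.lookup B v)"

text \<open>The coefficient of the principal divisor \<open>(f)\<close> at the point \<open>v\<close> is \<open>v f\<close>.\<close>

definition L_space :: "'f::field set \<Rightarrow> 'f divisor \<Rightarrow> 'f set" where
  "L_space K E =
     {f. f \<noteq> 0 \<and> (\<forall>v\<in>closed_points K. 0 \<le> v f + Poly_Mapping.lookup E v)} \<union> {0}"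

definition Gamma_set :: "'f::field set \<Rightarrow> ('f \<Rightarrow> int) \<Rightarrow> 'f divisor set" where
  "Gamma_set K P = {A \<in> divisors K. L_space K A \<noteq> L_space K (A - frag_of P)}"

definition Delta_set :: "'f::field set \<Rightarrow> ('f \<Rightarrow> int) \<Rightarrow> 'f divisor \<Rightarrow> 'f divisor set" where
  "Delta_set K P C = {A \<in> Gamma_set K P. A - C \<notin> Gamma_set K P}"

text \<open>The divisor \<open>E\<^sub>P\<close>, formed with respect to the second point \<open>Q\<close>.\<close>

definition min_shift ::
  "'f::field set \<Rightarrow> ('f \<Rightarrow> int) \<Rightarrow> ('f \<Rightarrow> int) \<Rightarrow> 'f divisor \<Rightarrow> 'f divisor" where
  "min_shift K Q P E =
     E + frag_cmul
           (LEAST k::int. L_space K (E + frag_cmul k (frag_of Q))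
                        \<noteq> L_space K (E + frag_cmul k (frag_of Q) - frag_of P))
           (frag_of Q)"

end

theory Submission
  imports Defs
begin

text \<open>
  For every divisor \<open>E\<close> the set of integers \<open>k\<close> with \<open>E + k Q \<in> \<Gamma>\<^sub>P\<close> is upward closed. If it is
  nonempty and bounded below, it has a least element \<open>m E\<close>, and each of the equivalences
  becomes a comparison of \<open>m A\<close> and \<open>m (A - C)\<close> with \<open>0\<close>.

  \<^item> As \<open>K\<close> is finite, the pigeonhole principle bounds the number of functions that are linearly independent
    over \<open>K[y]\<close>, for any function \<open>y\<close>.
  \<^item> A maximal subring not containing a nonconstant \<open>z\<close> is a valuation ring, discrete by the
    previous bound, so \<open>z\<close> has a pole. Hence a function without poles that vanishes at \<open>Q\<close> is zero.
  \<^item> Let \<open>y\<close> be a uniformizer at \<open>Q\<close>, \<open>N\<close> the maximal number of \<open>K[y]\<close>-independent functions, and \<open>O\<close> the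
    ring of functions regular at the other zeros of \<open>y\<close>. Then \<open>O / y O\<close> has dimension less than \<open>N\<close>, so
    among the \<open>|K| ^ (N (n + 1))\<close> combinations of the \<open>y ^ (- i) u\<^sub>j\<close> with \<open>i \<le> n\<close> more than \<open>|K|\<close> have the same
    principal parts away from \<open>Q\<close>; their differences give a nonconstant \<open>h\<close> with its only pole at \<open>Q\<close>.
  \<^item> An algebraic relation over \<open>K[h]\<close> for a function separating two points yields a separating function
    that is regular away from \<open>Q\<close>. Products of such functions have prescribed order at \<open>P\<close> and
    sufficiently large order at any other point except \<open>Q\<close>, which gives nonemptiness and the lower bound.
\<close>

section \<open>Finite constant fields and linear relations\<close>

text \<open>Dimension counts are replaced by counting coefficient tuples: there are
  \<open>card K ^ card I\<close> of them, so two distinct tuples have the same sum, and their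
  difference is the relation.\<close>

lemma pigeonhole_linear_relation:
  fixes K :: "'f::field set" and z :: "'i \<Rightarrow> 'f"
  assumes K: "finite K" "0 \<in> K" "\<And>a b. a \<in> K \<Longrightarrow> b \<in> K \<Longrightarrow> a - b \<in> K"
    and I: "finite I" and W: "finite W" "card W < card K ^ card I"
    and into: "\<And>a. (\<And>i. a i \<in> K) \<Longrightarrow> (\<Sum>i\<in>I. a i * z i) \<in> W"
  shows "\<exists>c. (\<forall>i. c i \<in> K) \<and> (\<exists>i\<in>I. c i \<noteq> 0) \<and> (\<Sum>i\<in>I. c i * z i) = 0"
proof -
  define \<phi> where "\<phi> a = (\<Sum>i\<in>I. a i * z i)" for a :: "'i \<Rightarrow> 'f"
  \<comment> \<open>Elements of \<open>I \<rightarrow>\<^sub>E K\<close> are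
    \<open>undefined\<close> outside \<open>I\<close>; \<open>ext\<close> puts 0 there so that all
    coefficients lie in \<open>K\<close>.\<close>
  define ext where "ext a = (\<lambda>i. if i \<in> I then a i else 0)" for a :: "'i \<Rightarrow> 'f"
  have ext_K: "ext a i \<in> K" if "a \<in> I \<rightarrow>\<^sub>E K" for a i
    using that K(2) by (auto simp: ext_def PiE_iff)
  have \<phi>_ext: "\<phi> (ext a) = \<phi> a" for a
    by (auto simp: \<phi>_def ext_def intro!: sum.cong)
  have "\<phi> ` (I \<rightarrow>\<^sub>E K) \<subseteq> W"
    using into ext_K \<phi>_ext by (metis (no_types, lifting) \<phi>_def image_subsetI)
  moreover have "card W < card (I \<rightarrow>\<^sub>E K)"
    using W(2) I by (simp add: card_PiE)
  ultimately have "\<not> inj_on \<phi> (I \<rightarrow>\<^sub>E K)"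
    using W(1) by (metis card_inj_on_le linorder_not_less)
  then obtain a b where ab: "a \<in> I \<rightarrow>\<^sub>E K" "b \<in> I \<rightarrow>\<^sub>E K" "\<phi> a = \<phi> b" "a \<noteq> b"
    by (auto simp: inj_on_def)
  then obtain i where "i \<in> I" "a i \<noteq> b i"
    by (metis PiE_ext)
  moreover have "(\<Sum>i\<in>I. (ext a i - ext b i) * z i) = 0"
    using ab(3) \<phi>_ext[of a] \<phi>_ext[of b] by (simp add: \<phi>_def left_diff_distrib sum_subtractf)
  ultimately show ?thesis
    using ab(1,2) ext_K K(3)
    by (intro exI[of _ "\<lambda>i. ext a i - ext b i"]) (auto simp: ext_def intro!: bexI[of _ i])
qed

locale constant_field =
  fixes K :: "'f::field set"
  assumes zero_in_K [simp, intro]: "0 \<in> K"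
    and one_in_K [simp, intro]: "1 \<in> K"
    and add_in_K [intro]: "a \<in> K \<Longrightarrow> b \<in> K \<Longrightarrow> a + b \<in> K"
    and uminus_in_K [intro]: "a \<in> K \<Longrightarrow> - a \<in> K"
    and mult_in_K [intro]: "a \<in> K \<Longrightarrow> b \<in> K \<Longrightarrow> a * b \<in> K"
    and inverse_in_K [intro]: "a \<in> K \<Longrightarrow> inverse a \<in> K"
    and finite_K [simp, intro]: "finite K"
begin

lemma diff_in_K [intro]: "a \<in> K \<Longrightarrow> b \<in> K \<Longrightarrow> a - b \<in> K"
  using add_in_K[of a "- b"] by auto

lemma card_K_ge_2: "card K \<ge> 2"
proof -
  have "card {0, 1::'f} \<le> card K"
    by (intro card_mono) auto
  then show ?thesis by simp
qed

section \<open>Spans with coefficients in the constants\<close>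

definition kspan :: "('i \<Rightarrow> 'f) \<Rightarrow> 'i set \<Rightarrow> 'f set" where
  "kspan z I = {\<Sum>i\<in>I. a i * z i | a. \<forall>i. a i \<in> K}"

lemma kspanI: "(\<And>i. a i \<in> K) \<Longrightarrow> (\<Sum>i\<in>I. a i * z i) \<in> kspan z I"
  by (auto simp: kspan_def)

lemma kspan_zero: "0 \<in> kspan z I"
  using kspanI[of "\<lambda>_. 0" z I] by simp

lemma kspan_add: "f \<in> kspan z I \<Longrightarrow> g \<in> kspan z I \<Longrightarrow> f + g \<in> kspan z I"
  unfolding kspan_def
  by clarify (rule_tac x = "\<lambda>i. a i + aa i" in exI, auto simp: distrib_right sum.distrib)

lemma kspan_scale: "c \<in> K \<Longrightarrow> f \<in> kspan z I \<Longrightarrow> c * f \<in> kspan z I"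
  unfolding kspan_def
  by clarify (rule_tac x = "\<lambda>i. c * a i" in exI, auto simp: sum_distrib_left mult_ac)

lemma kspan_sum: "(\<And>j. j \<in> J \<Longrightarrow> f j \<in> kspan z I) \<Longrightarrow> sum f J \<in> kspan z I"
  by (induction J rule: infinite_finite_induct) (auto intro: kspan_add kspan_zero)

lemma kspan_base:
  assumes "finite I" "i \<in> I" shows "z i \<in> kspan z I"
  using kspanI[of "\<lambda>j. if j = i then 1 else 0" z I] assms
  by (simp add: if_distrib[of "\<lambda>a. a * _"] cong: if_cong)

lemma kspan_subset:
  assumes "\<And>i. i \<in> I \<Longrightarrow> z i \<in> kspan z' I'" shows "kspan z I \<subseteq> kspan z' I'"
proof
  fix f assume "f \<in> kspan z I"
  then obtain a where a: "\<And>i. a i \<in> K" "f = (\<Sum>i\<in>I. a i * z i)"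
    by (auto simp: kspan_def)
  show "f \<in> kspan z' I'"
    unfolding a(2) by (intro kspan_sum kspan_scale a(1) assms)
qed

lemma kspan_mult:
  assumes "\<And>i. i \<in> I \<Longrightarrow> s * z i \<in> kspan z' I'" "f \<in> kspan z I" shows "s * f \<in> kspan z' I'"
proof -
  obtain a where a: "\<And>i. a i \<in> K" "f = (\<Sum>i\<in>I. a i * z i)"
    using assms(2) by (auto simp: kspan_def)
  have "s * f = (\<Sum>i\<in>I. a i * (s * z i))"
    by (simp add: a sum_distrib_left mult_ac)
  then show ?thesis
    by (simp only:) (intro kspan_sum kspan_scale a(1) assms(1))
qed

text \<open>Restricting the coefficients to \<open>I\<close> makes the span, for finite
  \<open>I\<close>, the image of a finite function space; this bounds its cardinality.\<close>

lemma kspan_ext: "f \<in> kspan z I \<longleftrightarrow> (\<exists>a\<in>I \<rightarrow>\<^sub>E K. f = (\<Sum>i\<in>I. a i * z i))"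
proof
  assume "f \<in> kspan z I"
  then obtain a where "\<And>i. a i \<in> K" "f = (\<Sum>i\<in>I. a i * z i)"
    by (auto simp: kspan_def)
  then show "\<exists>a\<in>I \<rightarrow>\<^sub>E K. f = (\<Sum>i\<in>I. a i * z i)"
    by (intro bexI[of _ "restrict a I"]) auto
next
  assume "\<exists>a\<in>I \<rightarrow>\<^sub>E K. f = (\<Sum>i\<in>I. a i * z i)"
  then obtain a where "a \<in> I \<rightarrow>\<^sub>E K" "f = (\<Sum>i\<in>I. a i * z i)" by blast
  then show "f \<in> kspan z I"
    unfolding kspan_def
    by (auto intro!: exI[of _ "\<lambda>i. if i \<in> I then a i else 0"] sum.cong)
qed

lemma finite_span: "finite I \<Longrightarrow> finite (kspan z I)"
  and card_span: "finite I \<Longrightarrow> card (kspan z I) \<le> card K ^ card I"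
proof -
  assume I: "finite I"
  have eq: "kspan z I = (\<lambda>a. \<Sum>i\<in>I. a i * z i) ` (I \<rightarrow>\<^sub>E K)"
    by (auto simp: kspan_ext)
  show "finite (kspan z I)"
    unfolding eq using I by (intro finite_imageI finite_PiE) auto
  show "card (kspan z I) \<le> card K ^ card I"
    unfolding eq using card_image_le[of "I \<rightarrow>\<^sub>E K"] I finite_PiE[of I "\<lambda>_. K"]
    by (simp add: card_PiE)
qed

section \<open>Polynomials in one function, filtered by degree\<close>

definition bpoly :: "'f \<Rightarrow> nat \<Rightarrow> 'f set" where
  "bpoly x n = kspan (\<lambda>i. x ^ i) {..n}"

lemma bpoly_mono: "n \<le> m \<Longrightarrow> bpoly x n \<subseteq> bpoly x m"
  unfolding bpoly_def by (intro kspan_subset kspan_base) auto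

lemma bpoly_mult:
  assumes "a \<in> bpoly x n" "b \<in> bpoly x m" shows "a * b \<in> bpoly x (n + m)"
  unfolding bpoly_def
proof (rule kspan_mult)
  fix i assume i: "i \<in> {..m}"
  have "x ^ i * a \<in> kspan (\<lambda>i. x ^ i) {..n + m}"
  proof (rule kspan_mult)
    fix j assume j: "j \<in> {..n}"
    have "x ^ (i + j) \<in> kspan (\<lambda>i. x ^ i) {..n + m}"
      using i j kspan_base[of "{..n+m}" "i + j" "\<lambda>i. x ^ i"] by auto
    then show "x ^ i * x ^ j \<in> kspan (\<lambda>i. x ^ i) {..n + m}"
      by (simp add: power_add)
  qed (use assms(1) in \<open>simp add: bpoly_def\<close>)
  then show "a * x ^ i \<in> kspan (\<lambda>i. x ^ i) {..n + m}"
    by (simp add: mult.commute)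
qed (use assms(2) in \<open>simp add: bpoly_def\<close>)

text \<open>The ring \<open>K[x]\<close> as the union of its pieces of bounded degree; the degree
  bounds feed the counting arguments.\<close>

definition adjoin :: "'f \<Rightarrow> 'f set" where
  "adjoin x = (\<Union>n. bpoly x n)"

lemma const_in_bpoly: "c \<in> K \<Longrightarrow> c \<in> bpoly x n"
  using kspan_scale[OF _ kspan_base[of "{..n}" 0 "\<lambda>i. x ^ i"], of c] by (simp add: bpoly_def)

lemma const_in_adjoin [intro]: "c \<in> K \<Longrightarrow> c \<in> adjoin x"
  using const_in_bpoly by (auto simp: adjoin_def)

lemma self_in_adjoin [simp, intro]: "x \<in> adjoin x"
  using kspan_base[of "{..1}" 1 "\<lambda>i. x ^ i"] by (auto simp: adjoin_def bpoly_def)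

lemma adjoin_add [intro]:
  assumes "a \<in> adjoin x" "b \<in> adjoin x" shows "a + b \<in> adjoin x"
proof -
  obtain n m where "a \<in> bpoly x n" "b \<in> bpoly x m" using assms by (auto simp: adjoin_def)
  then have "a \<in> bpoly x (n + m)" "b \<in> bpoly x (n + m)"
    using bpoly_mono[of n "n + m" x] bpoly_mono[of m "n + m" x] by auto
  then have "a + b \<in> bpoly x (n + m)" unfolding bpoly_def by (rule kspan_add)
  then show ?thesis by (auto simp: adjoin_def)
qed

lemma adjoin_mult [intro]: "a \<in> adjoin x \<Longrightarrow> b \<in> adjoin x \<Longrightarrow> a * b \<in> adjoin x"
  using bpoly_mult unfolding adjoin_def by blast

lemma adjoin_uminus [intro]: "a \<in> adjoin x \<Longrightarrow> - a \<in> adjoin x"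
  using adjoin_mult[of "-1" x a] const_in_adjoin[of "-1" x] by auto

lemma adjoin_sum: "(\<And>i. i \<in> I \<Longrightarrow> f i \<in> adjoin x) \<Longrightarrow> sum f I \<in> adjoin x"
  by (induction I rule: infinite_finite_induct) auto

lemma adjoin_prod: "(\<And>i. i \<in> I \<Longrightarrow> f i \<in> adjoin x) \<Longrightarrow> prod f I \<in> adjoin x"
  by (induction I rule: infinite_finite_induct) auto

lemma adjoin_power: "a \<in> adjoin x \<Longrightarrow> a ^ n \<in> adjoin x"
  by (induction n) auto

lemma adjoin_least:
  assumes "f \<in> adjoin x" "K \<subseteq> B" "x \<in> B" "\<And>a b. a \<in> B \<Longrightarrow> b \<in> B \<Longrightarrow> a + b \<in> B"
    "\<And>a b. a \<in> B \<Longrightarrow> b \<in> B \<Longrightarrow> a * b \<in> B"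
  shows "f \<in> B"
proof -
  obtain n a where a: "\<And>i. a i \<in> K" "f = (\<Sum>i\<le>n. a i * x ^ i)"
    using assms(1) by (auto simp: adjoin_def bpoly_def kspan_def)
  have pow: "x ^ i \<in> B" for i
    using assms by (induction i) auto
  have "(\<Sum>i\<le>n. a i * x ^ i) \<in> B"
    using assms(2,4,5) a(1) pow by (induction n) (auto simp: subset_iff simp del: power_Suc)
  then show ?thesis using a by simp
qed

text \<open>Dependence of \<open>g 0, ..., g (m - 1)\<close> over \<open>K[y]\<close>, all
  coefficient polynomials being written out up to a common degree \<open>n\<close>. Nontriviality is
  required of the coefficients \<open>c j i\<close> and not of the values, so this is genuine
  dependence for transcendental \<open>y\<close>, while for \<open>y\<close> in \<open>K\<close> it
  holds as soon as \<open>m > 0\<close>.\<close>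

definition dependent :: "'f \<Rightarrow> (nat \<Rightarrow> 'f) \<Rightarrow> nat \<Rightarrow> bool" where
  "dependent y g m \<longleftrightarrow> (\<exists>n c. (\<forall>j i. c j i \<in> K) \<and> (\<exists>j<m. \<exists>i\<le>n. c j i \<noteq> 0) \<and>
     (\<Sum>j<m. \<Sum>i\<le>n. c j i * y ^ i * g j) = 0)"

text \<open>Divide by the highest power \<open>y ^ l\<close> that divides every coefficient
  polynomial. The remaining constant terms are not all zero, so the relation stays nontrivial modulo
  \<open>y\<close>; in this form orders of its terms can be compared.\<close>

lemma dependent_normal:
  assumes "y \<noteq> 0" "dependent y g m"
  obtains c r where "\<And>j. c j \<in> K" "\<And>j. r j \<in> adjoin y" "\<exists>j<m. c j \<noteq> 0"
    "(\<Sum>j<m. (c j + y * r j) * g j) = 0"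
proof -
  obtain n c where c: "\<And>j i. c j i \<in> K" "\<exists>i. i \<le> n \<and> (\<exists>j<m. c j i \<noteq> 0)"
    "(\<Sum>j<m. \<Sum>i\<le>n. c j i * y ^ i * g j) = 0"
    using assms(2) unfolding dependent_def by blast
  define l where "l = (LEAST i. i \<le> n \<and> (\<exists>j<m. c j i \<noteq> 0))"
  have l: "l \<le> n" "\<exists>j<m. c j l \<noteq> 0"
    using LeastI_ex[OF c(2)] by (auto simp: l_def)
  have below: "c j i = 0" if "i < l" "j < m" for i j
    using not_less_Least[OF that(1)[unfolded l_def]] that l(1) by auto
  define r where "r j = (\<Sum>i<n - l. c j (Suc (i + l)) * y ^ i)" for j
  have split: "(\<Sum>i\<le>n. c j i * y ^ i * g j) = y ^ l * ((c j l + y * r j) * g j)" if "j < m" for j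
  proof -
    have "(\<Sum>i\<le>n. c j i * y ^ i) = (\<Sum>i\<in>{l..n}. c j i * y ^ i)"
      using below that by (intro sum.mono_neutral_right) auto
    also have "\<dots> = (\<Sum>i\<in>{0 + l..(n - l) + l}. c j i * y ^ i)"
      using l(1) by simp
    also have "\<dots> = (\<Sum>i\<le>n - l. c j (i + l) * y ^ (i + l))"
      unfolding sum.shift_bounds_cl_nat_ivl by (simp add: atLeast0AtMost)
    also have "\<dots> = y ^ l * (\<Sum>i\<le>n - l. c j (i + l) * y ^ i)"
      by (simp add: sum_distrib_left power_add mult_ac)
    also have "(\<Sum>i\<le>n - l. c j (i + l) * y ^ i) = c j l + y * r j"
      unfolding sum.atMost_shift r_def by (simp add: sum_distrib_left mult_ac)
    finally show ?thesis by (simp flip: sum_distrib_right)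
  qed
  have "y ^ l * (\<Sum>j<m. (c j l + y * r j) * g j) = 0"
    using c(3) split by (simp add: sum_distrib_left)
  moreover have "r j \<in> adjoin y" for j
    unfolding r_def using c(1) by (auto intro!: adjoin_sum adjoin_mult adjoin_power)
  ultimately show ?thesis
    using that[of "\<lambda>j. c j l" r] c(1) l(2) assms(1) by auto
qed

lemma dependent_scale:
  assumes "s \<noteq> 0" "dependent y (\<lambda>j. s * g j) m" shows "dependent y g m"
proof -
  obtain n c where c: "\<And>j i. c j i \<in> K" "\<exists>j<m. \<exists>i\<le>n. c j i \<noteq> 0"
    "(\<Sum>j<m. \<Sum>i\<le>n. c j i * y ^ i * (s * g j)) = 0"
    using assms(2) unfolding dependent_def by blast
  have "s * (\<Sum>j<m. \<Sum>i\<le>n. c j i * y ^ i * g j) = 0"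
    using c(3) by (simp add: sum_distrib_left mult_ac)
  then show ?thesis unfolding dependent_def using c assms(1) by auto
qed

text \<open>Clearing the denominators of a relation in \<open>1 / y\<close> reverses the coefficients.\<close>

lemma dependent_inverse:
  assumes "y \<noteq> 0" "\<And>j i. c j i \<in> K" "j0 < m" "i0 \<le> n" "c j0 i0 \<noteq> 0"
    "(\<Sum>j<m. \<Sum>i\<le>n. c j i * inverse y ^ i * g j) = 0"
  shows "dependent y g m"
proof -
  have "(\<Sum>i\<le>n. c j (n - i) * y ^ i * g j) = y ^ n * (\<Sum>i\<le>n. c j i * inverse y ^ i * g j)" for j
  proof -
    have "(\<Sum>i\<le>n. c j (n - i) * y ^ i * g j) = (\<Sum>i\<le>n. c j i * y ^ (n - i) * g j)"
      by (rule sum.reindex_bij_witness[of _ "\<lambda>i. n - i" "\<lambda>i. n - i"]) auto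
    also have "\<dots> = (\<Sum>i\<le>n. y ^ n * (c j i * inverse y ^ i * g j))"
      using assms(1) by (intro sum.cong) (auto simp: power_diff power_inverse field_simps)
    finally show ?thesis by (simp add: sum_distrib_left)
  qed
  then have "(\<Sum>j<m. \<Sum>i\<le>n. c j (n - i) * y ^ i * g j) = 0"
    using assms(6) by (simp flip: sum_distrib_left)
  moreover have "\<exists>j<m. \<exists>i\<le>n. c j (n - i) \<noteq> 0"
    using assms(3-5) by (intro exI[of _ j0] conjI exI[of _ "n - i0"]) auto
  ultimately show ?thesis unfolding dependent_def using assms(2)
    by (intro exI[of _ n] exI[of _ "\<lambda>j i. c j (n - i)"]) auto
qed

end

text \<open>The first axiom is that nonconstant elements are transcendental over \<open>K\<close>.
  The second is finiteness over \<open>K(x)\<close> with the denominators cleared, which avoids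
  speaking of \<open>K(x)\<close> itself.\<close>

locale function_field = constant_field K for K :: "'f::field set" +
  assumes transcendental: "z \<notin> K \<Longrightarrow> (\<And>i. c i \<in> K) \<Longrightarrow> (\<Sum>i\<le>n. c i * z ^ i) = 0 \<Longrightarrow> i \<le> n \<Longrightarrow> c i = 0"
    and finite_extension: "\<exists>x e (N::nat). \<forall>f. \<exists>d\<in>adjoin x. \<exists>a. d \<noteq> 0 \<and> (\<forall>k. a k \<in> adjoin x) \<and>
           d * f = (\<Sum>k<N. a k * e k)"
begin

text \<open>Filter the field by the spans \<open>W n\<close> of the \<open>x ^ i * e k\<close> with
  \<open>i \<le> n\<close>, of dimension at most \<open>N * (n + 1)\<close>. Up to a fixed
  denominator, \<open>y\<close> raises the filtration by a constant \<open>c\<close>. Cleared of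
  denominators, the \<open>m * (n + 1)\<close> functions \<open>y ^ i * g j\<close> thus lie in a
  space whose dimension grows like \<open>N * c * n\<close>, and they are dependent for large
  \<open>n\<close> once \<open>m > N * c\<close>, a bound independent of \<open>g\<close>.\<close>

lemma dependent_large: "\<exists>M. \<forall>m\<ge>M. \<forall>g. dependent y g m"
proof -
  obtain x e and N :: nat where gen:
    "\<And>f. \<exists>d\<in>adjoin x. \<exists>a. d \<noteq> 0 \<and> (\<forall>k. a k \<in> adjoin x) \<and> d * f = (\<Sum>k<N. a k * e k)"
    using finite_extension by blast
  define W where "W n = kspan (\<lambda>(k, i). x ^ i * e k) ({..<N} \<times> {..n})" for n :: nat
  have finW: "finite (W n)" and cardW: "card (W n) \<le> card K ^ (N * Suc n)" for n
    unfolding W_def using card_span[of "{..<N} \<times> {..n}"] by (auto intro!: finite_span)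
  have W_mono: "W n \<subseteq> W m" if "n \<le> m" for n m
    unfolding W_def using that by (intro kspan_subset kspan_base) auto
  have baseW: "x ^ i * e k \<in> W n" if "k < N" "i \<le> n" for k i n
    using kspan_base[of "{..<N} \<times> {..n}" "(k, i)" "\<lambda>(k, i). x ^ i * e k"] that
    by (simp add: W_def)
  have powW: "x ^ i * f \<in> W (n + i)" if "f \<in> W n" for f i n
    unfolding W_def
  proof (rule kspan_mult[OF _ that[unfolded W_def]])
    fix p assume "p \<in> {..<N} \<times> {..n}"
    then show "x ^ i * (case p of (k, j) \<Rightarrow> x ^ j * e k)
        \<in> kspan (\<lambda>(k, i). x ^ i * e k) ({..<N} \<times> {..n + i})"
      using baseW[of "fst p" "i + snd p" "n + i"]
      by (auto simp: W_def power_add mult_ac split: prod.splits)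
  qed
  have multW: "d * f \<in> W (n + m)" if "d \<in> bpoly x m" "f \<in> W n" for d f n m
  proof -
    have "f * d \<in> W (n + m)"
      unfolding W_def
    proof (rule kspan_mult)
      fix i assume "i \<in> {..m}"
      then show "f * x ^ i \<in> kspan (\<lambda>(k, i). x ^ i * e k) ({..<N} \<times> {..n + m})"
        using powW[OF that(2), of i] W_mono[of "n + i" "n + m"] by (auto simp: W_def mult.commute)
    qed (use that(1) in \<open>simp add: bpoly_def\<close>)
    then show ?thesis by (simp add: mult.commute)
  qed
  have sumW: "sum f J \<in> W n" if "\<And>j. j \<in> J \<Longrightarrow> f j \<in> W n" for f and J :: "nat set" and n
    using that unfolding W_def by (rule kspan_sum)
  have denom1: "\<exists>d n. d \<noteq> 0 \<and> d \<in> bpoly x n \<and> d * f \<in> W n" for f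
  proof -
    obtain d a where da: "d \<in> adjoin x" "d \<noteq> 0" "\<And>k. a k \<in> adjoin x"
      "d * f = (\<Sum>k<N. a k * e k)" using gen[of f] by blast
    obtain n0 where n0: "d \<in> bpoly x n0" using da(1) by (auto simp: adjoin_def)
    have "\<forall>k. \<exists>n. a k \<in> bpoly x n" using da(3) by (simp add: adjoin_def)
    then obtain \<nu> where \<nu>: "\<And>k. a k \<in> bpoly x (\<nu> k)" by metis
    define n where "n = n0 + (\<Sum>k<N. \<nu> k)"
    have "a k * e k \<in> W n" if "k < N" for k
    proof -
      have "\<nu> k \<le> n" using that unfolding n_def
        by (intro trans_le_add2 member_le_sum) auto
      moreover have "e k \<in> W 0" using baseW[of k 0 0] that by simp
      ultimately show ?thesis
        using multW[OF \<nu>[of k], of "e k" 0] W_mono by (metis add_0 subsetD)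
    qed
    then have "d * f \<in> W n" unfolding da(4) by (intro sumW) auto
    moreover have "d \<in> bpoly x n" using n0 bpoly_mono[of n0 n x] by (auto simp: n_def)
    ultimately show ?thesis using da(2) by blast
  qed
  have denom: "\<exists>d n. d \<noteq> 0 \<and> d \<in> bpoly x n \<and> (\<forall>j<m. d * f j \<in> W n)" for f and m :: nat
  proof (induction m)
    case 0
    show ?case using const_in_bpoly[of 1 x 0] by (intro exI[of _ 1] exI[of _ 0]) auto
  next
    case (Suc m)
    then obtain d n where d: "d \<noteq> 0" "d \<in> bpoly x n" "\<And>j. j < m \<Longrightarrow> d * f j \<in> W n" by blast
    obtain d' n' where d': "d' \<noteq> 0" "d' \<in> bpoly x n'" "d' * f m \<in> W n'" using denom1 by blast
    have "d' * (d * f j) \<in> W (n + n')" if "j < m" for j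
      using multW[OF d'(2) d(3)[OF that]] .
    moreover have "d * (d' * f m) \<in> W (n' + n)" by (rule multW[OF d(2) d'(3)])
    ultimately have "\<forall>j<Suc m. (d * d') * f j \<in> W (n + n')"
      by (auto simp: less_Suc_eq mult_ac add_ac)
    moreover have "d * d' \<in> bpoly x (n + n')" using bpoly_mult d d' by blast
    moreover have "d * d' \<noteq> 0" using d(1) d'(1) by simp
    ultimately show ?case by blast
  qed
  \<comment> \<open>\<open>d\<close> clears the denominators of all \<open>y * e k\<close>;
    \<open>c\<close> is the growth rate of multiplication by \<open>d * y\<close>.\<close>
  obtain d c where d: "d \<noteq> 0" "d \<in> bpoly x c" "\<And>k. k < N \<Longrightarrow> d * (y * e k) \<in> W c"
    using denom[of N "\<lambda>k. y * e k"] by blast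
  have step: "(d * y) * f \<in> W (n + c)" if "f \<in> W n" for f n
    unfolding W_def
  proof (rule kspan_mult)
    fix p assume p: "p \<in> {..<N} \<times> {..n}"
    have "x ^ snd p * (d * (y * e (fst p))) \<in> W (c + snd p)"
      by (rule powW) (use p d(3) in auto)
    then have "x ^ snd p * (d * (y * e (fst p))) \<in> W (n + c)"
      using W_mono[of "c + snd p" "n + c"] p by auto
    then show "d * y * (case p of (k, i) \<Rightarrow> x ^ i * e k)
      \<in> kspan (\<lambda>(k, i). x ^ i * e k) ({..<N} \<times> {..n + c})"
      by (auto simp: W_def mult_ac split: prod.splits)
  qed (use that in \<open>simp add: W_def\<close>)
  have steps: "(d * y) ^ i * f \<in> W (n + c * i)" if "f \<in> W n" for f n i
  proof (induction i)
    case (Suc i)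
    show ?case using step[OF Suc] by (simp add: mult_ac add_ac)
  qed (use that in simp)
  have dsteps: "d ^ i * f \<in> W (n + c * i)" if "f \<in> W n" for f n i
  proof (induction i)
    case (Suc i)
    show ?case using multW[OF d(2) Suc] by (simp add: mult_ac add_ac)
  qed (use that in simp)
  have "dependent y g m" if m: "m \<ge> N * c + 1" for m g
  proof -
    obtain d' c' where d': "d' \<noteq> 0" "d' \<in> bpoly x c'" "\<And>j. j < m \<Longrightarrow> d' * g j \<in> W c'"
      using denom[of m g] by blast
    \<comment> \<open>With this \<open>n\<close>, \<open>(N * c + 1) * (n + 1)\<close> exceeds
      \<open>N * (c' + c * n + 1)\<close>, so the tuples outnumber the space.\<close>
    define n where "n = N * Suc c'"
    define D where "D = d ^ n * d'"
    have D0: "D \<noteq> 0" using d d' by (simp add: D_def)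
    \<comment> \<open>Of the factors \<open>d ^ n\<close>, \<open>i\<close> are used up by
      \<open>y ^ i\<close>; the other \<open>n - i\<close> merely raise the filtration.\<close>
    have inW: "D * (y ^ i * g j) \<in> W (c' + c * n)" if "i \<le> n" "j < m" for i j
    proof -
      have "d ^ (n - i) * ((d * y) ^ i * (d' * g j)) \<in> W (c' + c * i + c * (n - i))"
        by (intro dsteps steps d'(3) that)
      moreover have "c' + c * i + c * (n - i) = c' + c * n"
        using that by (simp flip: distrib_left)
      moreover have "d ^ (n - i) * ((d * y) ^ i * (d' * g j)) = (d ^ (n - i) * d ^ i) * d' * (y ^ i * g j)"
        by (simp add: power_mult_distrib mult_ac)
      moreover have "d ^ (n - i) * d ^ i = d ^ n"
        using that by (simp flip: power_add)
      ultimately show ?thesis by (simp add: D_def)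
    qed
    have less: "N * Suc (c' + c * n) < m * Suc n"
    proof -
      have "(N * c + 1) * Suc n \<le> m * Suc n" using m by (rule mult_right_mono) simp
      then show ?thesis by (simp add: n_def algebra_simps)
    qed
    define I where "I = {..<m} \<times> {..n}"
    define z where "z p = D * (y ^ snd p * g (fst p))" for p :: "nat \<times> nat"
    have "\<exists>a. (\<forall>p. a p \<in> K) \<and> (\<exists>p\<in>I. a p \<noteq> 0) \<and> (\<Sum>p\<in>I. a p * z p) = 0"
    proof (rule pigeonhole_linear_relation)
      show "(\<Sum>p\<in>I. a p * z p) \<in> W (c' + c * n)" if "\<And>p. a p \<in> K" for a
        unfolding W_def
        by (intro kspan_sum kspan_scale that, fold W_def) (auto simp: z_def I_def intro!: inW)
      have "card (W (c' + c * n)) \<le> card K ^ (N * Suc (c' + c * n))" by (rule cardW)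
      also have "\<dots> < card K ^ (m * Suc n)"
        using less card_K_ge_2 by (intro power_strict_increasing) auto
      finally show "card (W (c' + c * n)) < card K ^ card I"
        by (simp add: I_def)
    qed (use finW in \<open>auto simp: I_def\<close>)
    then obtain a where a: "\<And>p. a p \<in> K" "\<exists>p\<in>I. a p \<noteq> 0" "(\<Sum>p\<in>I. a p * z p) = 0" by blast
    have "D * (\<Sum>j<m. \<Sum>i\<le>n. a (j, i) * y ^ i * g j) = (\<Sum>j<m. \<Sum>i\<le>n. a (j, i) * z (j, i))"
      by (simp add: sum_distrib_left z_def mult_ac)
    also have "\<dots> = (\<Sum>p\<in>I. a p * z p)"
      by (simp add: I_def sum.cartesian_product case_prod_unfold)
    finally have "(\<Sum>j<m. \<Sum>i\<le>n. a (j, i) * y ^ i * g j) = 0"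
      using a(3) D0 by simp
    then show ?thesis
      unfolding dependent_def using a(1,2)
      by (intro exI[of _ n] exI[of _ "\<lambda>j i. a (j, i)"]) (auto simp: I_def)
  qed
  then show ?thesis by blast
qed

end

section \<open>Existence of poles\<close>

text \<open>The dummy value \<open>v 0 = 0\<close> is overridden: \<open>0\<close> has infinite order.\<close>

definition vge :: "('f::field \<Rightarrow> int) \<Rightarrow> int \<Rightarrow> 'f \<Rightarrow> bool" where
  "vge v k f \<longleftrightarrow> f = 0 \<or> k \<le> v f"

lemma vge_0 [simp]: "vge v k 0"
  by (simp add: vge_def)

lemma vge_mono: "vge v k f \<Longrightarrow> l \<le> k \<Longrightarrow> vge v l f"
  by (auto simp: vge_def)

section \<open>Orders of functions at a single point\<close>

context constant_field
begin

context
  fixes v :: "'f \<Rightarrow> int"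
  assumes v: "v \<in> closed_points K"
begin

lemma val_mult: "f \<noteq> 0 \<Longrightarrow> g \<noteq> 0 \<Longrightarrow> v (f * g) = v f + v g"
  and val_add: "f \<noteq> 0 \<Longrightarrow> g \<noteq> 0 \<Longrightarrow> f + g \<noteq> 0 \<Longrightarrow> min (v f) (v g) \<le> v (f + g)"
  and val_const: "c \<in> K \<Longrightarrow> v c = 0"
  and val_uniformizer: "\<exists>t. t \<noteq> 0 \<and> v t = 1"
proof -
  show "v c = 0" if "c \<in> K"
    using v that unfolding closed_points_def by (cases "c = 0") auto
qed (use v in \<open>auto simp: closed_points_def\<close>)

lemma val_one: "v 1 = 0"
  by (simp add: val_const)

lemma val_inverse: "v (inverse f) = - v f"
proof (cases "f = 0")
  case False
  then have "v f + v (inverse f) = v (f * inverse f)"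
    by (intro val_mult[symmetric]) auto
  then show ?thesis using False val_one by simp
qed (simp add: val_const)

lemma val_divide: "f \<noteq> 0 \<Longrightarrow> g \<noteq> 0 \<Longrightarrow> v (f / g) = v f - v g"
  by (simp add: divide_inverse val_mult val_inverse)

lemma val_uminus: "v (- f) = v f"
proof (cases "f = 0")
  case False
  then have "v (- 1 * f) = v (- 1) + v f"
    by (intro val_mult) auto
  then show ?thesis by (simp add: val_const uminus_in_K)
qed simp

lemma val_power: "f \<noteq> 0 \<Longrightarrow> v (f ^ n) = int n * v f"
  by (induction n) (simp_all add: val_one val_mult algebra_simps)

lemma val_powi: "f \<noteq> 0 \<Longrightarrow> v (f powi k) = k * v f"
  by (cases "k \<ge> 0") (simp_all add: power_int_def val_power val_inverse)

lemma vge_add: "vge v k f \<Longrightarrow> vge v k g \<Longrightarrow> vge v k (f + g)"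
  using val_add[of f g] by (cases "f = 0"; cases "g = 0"; cases "f + g = 0") (auto simp: vge_def)

lemma vge_uminus: "vge v k f \<Longrightarrow> vge v k (- f)"
  by (simp add: vge_def val_uminus)

lemma vge_diff: "vge v k f \<Longrightarrow> vge v k g \<Longrightarrow> vge v k (f - g)"
  using vge_add[of k f "- g"] vge_uminus[of k g] by simp

lemma vge_sum: "(\<And>i. i \<in> I \<Longrightarrow> vge v k (f i)) \<Longrightarrow> vge v k (sum f I)"
  by (induction I rule: infinite_finite_induct) (auto intro: vge_add)

lemma vge_mult: "vge v k f \<Longrightarrow> vge v l g \<Longrightarrow> vge v (k + l) (f * g)"
  using val_mult[of f g] by (cases "f = 0"; cases "g = 0") (auto simp: vge_def)

lemma vge_const: "c \<in> K \<Longrightarrow> vge v 0 c"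
  by (simp add: vge_def val_const)

lemma vge_const_mult: "c \<in> K \<Longrightarrow> vge v k f \<Longrightarrow> vge v k (c * f)"
  using vge_mult[of 0 c k f] vge_const by simp

lemma vge_mult_nonneg: "vge v 0 f \<Longrightarrow> vge v 0 g \<Longrightarrow> vge v 0 (f * g)"
  using vge_mult[of 0 f 0 g] by simp

lemma vge_power_nonneg: "vge v 0 f \<Longrightarrow> vge v 0 (f ^ n)"
  by (induction n) (auto simp: vge_const vge_mult_nonneg)

lemma vge_prod_nonneg: "(\<And>i. i \<in> I \<Longrightarrow> vge v 0 (f i)) \<Longrightarrow> vge v 0 (prod f I)"
  by (induction I rule: infinite_finite_induct) (auto simp: vge_const vge_mult_nonneg)

lemma vge_adjoin: "p \<in> adjoin x \<Longrightarrow> vge v 0 x \<Longrightarrow> vge v 0 p"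
  using adjoin_least[of p x "{f. vge v 0 f}"] 
  by (simp add: vge_const vge_add vge_mult_nonneg subset_iff)

text \<open>The ultrametric inequality applied to \<open>f + g\<close> and also to
  \<open>f = (f + g) - g\<close> gives both bounds.\<close>

lemma val_add_dominant:
  assumes "f \<noteq> 0" "vge v (v f + 1) g"
  shows "f + g \<noteq> 0" "v (f + g) = v f"
proof -
  show nz: "f + g \<noteq> 0"
    using assms val_uminus[of f] by (auto simp: vge_def add_eq_0_iff)
  show "v (f + g) = v f"
  proof (cases "g = 0")
    case False
    then have "min (v (f + g)) (v (- g)) \<le> v f"
      using val_add[of "f + g" "- g"] nz assms(1) by simp
    then show ?thesis
      using val_add[OF assms(1) False nz] assms(2) False by (auto simp: vge_def val_uminus)
  qed simp
qed

lemma val_const_add: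
  assumes "c \<in> K" "c \<noteq> 0" "vge v 1 s" shows "c + s \<noteq> 0" "v (c + s) = 0"
  using val_add_dominant[of c s] assms by (auto simp: val_const)

lemma val_nonzero_not_const: "v f \<noteq> 0 \<Longrightarrow> f \<notin> K"
  using val_const by auto

end

end

section \<open>Discrete valuation rings from maximal subrings\<close>

context function_field
begin

text \<open>Zorn's lemma gives a ring \<open>B\<close> maximal among those containing
  \<open>K\<close> and \<open>w = 1 / z\<close> but not \<open>z\<close>. Chevalley's argument shows
  that \<open>B\<close> contains \<open>u\<close> or \<open>1 / u\<close> for every
  \<open>u\<close>. By \<open>dependent_large\<close> its nonunits form a principal ideal with a
  generator \<open>t\<close>, and no nonzero element of \<open>B\<close> is divisible by all powers
  of \<open>t\<close>. The exponent of \<open>t\<close> is the valuation; it is negative at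
  \<open>z\<close> because \<open>z\<close> is outside \<open>B\<close>.\<close>

lemma pole_exists:
  assumes z: "z \<notin> K"
  shows "\<exists>v\<in>closed_points K. v z < 0"
proof -
  define w where "w = inverse z"
  have z0: "z \<noteq> 0" and w0: "w \<noteq> 0" and zw: "z * w = 1" and inv_w: "inverse w = z"
    using z zero_in_K by (cases "z = 0"; simp add: w_def)+
  define \<A> where "\<A> = {B. K \<subseteq> B \<and> w \<in> B \<and> z \<notin> B \<and> (\<forall>a\<in>B. \<forall>b\<in>B. a + b \<in> B \<and> a * b \<in> B)}"
  \<comment> \<open>Multiplied by \<open>z ^ n\<close>, an expression of \<open>z\<close> as a
    polynomial in \<open>w\<close> becomes a monic equation for \<open>z\<close> over
    \<open>K\<close>.\<close>
  have "z \<notin> adjoin w"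
  proof
    assume "z \<in> adjoin w"
    then obtain n a where a: "\<And>i. a i \<in> K" "z = (\<Sum>i\<le>n. a i * w ^ i)"
      by (auto simp: adjoin_def bpoly_def kspan_def)
    define c where "c i = (if i = Suc n then 1 else - a (n - i))" for i
    have "(\<Sum>i\<le>Suc n. c i * z ^ i) = z ^ Suc n - (\<Sum>i\<le>n. a (n - i) * z ^ i)"
      by (simp add: c_def sum_negf)
    also have "(\<Sum>i\<le>n. a (n - i) * z ^ i) = (\<Sum>i\<le>n. a i * z ^ (n - i))"
      by (rule sum.reindex_bij_witness[of _ "\<lambda>i. n - i" "\<lambda>i. n - i"]) auto
    also have "\<dots> = (\<Sum>i\<le>n. z ^ n * (a i * w ^ i))"
      using z0 by (intro sum.cong) (auto simp: w_def power_diff power_inverse field_simps)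
    also have "\<dots> = z ^ n * z"
      by (simp only: a(2)[symmetric] flip: sum_distrib_left)
    finally have "(\<Sum>i\<le>Suc n. c i * z ^ i) = 0" by simp
    moreover have "c i \<in> K" for i using a(1) by (auto simp: c_def)
    ultimately have "c (Suc n) = 0"
      using transcendental[OF z, of c "Suc n" "Suc n"] by blast
    then show False by (simp add: c_def)
  qed
  then have "adjoin w \<in> \<A>" by (auto simp: \<A>_def)
  moreover have "(\<Union>\<C>) \<in> \<A>" if chain: "\<C> \<noteq> {}" "subset.chain \<A> \<C>" for \<C>
  proof -
    have sub: "\<And>B. B \<in> \<C> \<Longrightarrow> B \<in> \<A>" and tot: "\<And>B1 B2. B1 \<in> \<C> \<Longrightarrow> B2 \<in> \<C> \<Longrightarrow> B1 \<subseteq> B2 \<or> B2 \<subseteq> B1"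
      using that(2) by (auto simp: subset_chain_def)
    have "a + b \<in> (\<Union>\<C>) \<and> a * b \<in> (\<Union>\<C>)" if ab: "a \<in> (\<Union>\<C>)" "b \<in> (\<Union>\<C>)" for a b
    proof -
      obtain B1 B2 where "B1 \<in> \<C>" "B2 \<in> \<C>" "a \<in> B1" "b \<in> B2" using ab by blast
      then obtain B3 where "B3 \<in> \<C>" "a \<in> B3" "b \<in> B3" using tot[of B1 B2] by blast
      then show ?thesis using sub[of B3] by (auto simp: \<A>_def)
    qed
    moreover obtain B1 where "B1 \<in> \<C>" using chain(1) by blast
    ultimately show ?thesis using sub unfolding \<A>_def by blast
  qed
  ultimately obtain B where B: "B \<in> \<A>" and Bmax: "\<And>B1. B1 \<in> \<A> \<Longrightarrow> B \<subseteq> B1 \<Longrightarrow> B1 = B"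
    using subset_Zorn_nonempty[of \<A>] by blast
  have KB: "\<And>c. c \<in> K \<Longrightarrow> c \<in> B" and wB: "w \<in> B" and zB: "z \<notin> B"
    and addB: "\<And>a b. a \<in> B \<Longrightarrow> b \<in> B \<Longrightarrow> a + b \<in> B"
    and mulB: "\<And>a b. a \<in> B \<Longrightarrow> b \<in> B \<Longrightarrow> a * b \<in> B"
    using B by (auto simp: \<A>_def)
  have [simp]: "0 \<in> B" "1 \<in> B" using KB by auto
  have minB: "- a \<in> B" if "a \<in> B" for a
    using mulB[of "- 1" a] KB[of "- 1"] that by auto
  have powB: "a ^ n \<in> B" if "a \<in> B" for a n
    using that by (induction n) (auto intro: mulB)
  have sumB: "sum f J \<in> B" if "\<And>j. j \<in> J \<Longrightarrow> f j \<in> B" for f and J :: "nat set"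
    using that by (induction J rule: infinite_finite_induct) (auto intro: addB)
  have adjB: "p \<in> B" if "p \<in> adjoin x" "x \<in> B" for p x
    using adjoin_least[OF that(1), of B] that(2) KB addB mulB by auto
  \<comment> \<open>By maximality, adjoining \<open>u\<close> to \<open>B\<close> must produce
    \<open>z\<close>.\<close>
  have ext: "\<exists>n b. (\<forall>i. b i \<in> B) \<and> z = (\<Sum>i\<le>n. b i * u ^ i)" if u: "u \<notin> B" for u
  proof -
    define B1 where "B1 = {poly p u | p. \<forall>i. coeff p i \<in> B}"
    have "B \<subseteq> B1"
    proof
      fix b assume "b \<in> B"
      then show "b \<in> B1" unfolding B1_def
        by (intro CollectI exI[of _ "[:b:]"]) (auto simp: coeff_pCons split: nat.split)
    qed
    moreover have "u \<in> B1" unfolding B1_def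
      by (intro CollectI exI[of _ "[:0, 1:]"]) (auto simp: coeff_pCons split: nat.split)
    moreover have "a + b \<in> B1" "a * b \<in> B1" if ab: "a \<in> B1" "b \<in> B1" for a b
    proof -
      obtain p q where pq: "\<And>i. coeff p i \<in> B" "\<And>i. coeff q i \<in> B" "a = poly p u" "b = poly q u"
        using ab by (auto simp: B1_def)
      show "a + b \<in> B1" unfolding B1_def using pq
        by (intro CollectI exI[of _ "p + q"]) (auto intro: addB)
      show "a * b \<in> B1" unfolding B1_def using pq
        by (intro CollectI exI[of _ "p * q"]) (auto simp: coeff_mult intro!: sumB mulB)
    qed
    ultimately have "z \<in> B1"
      using Bmax[of B1] u KB wB unfolding \<A>_def by blast
    then obtain p where "\<And>i. coeff p i \<in> B" "z = poly p u" by (auto simp: B1_def)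
    then show ?thesis
      by (intro exI[of _ "degree p"] exI[of _ "coeff p"]) (auto simp: poly_altdef)
  qed
  \<comment> \<open>If \<open>1 / s\<close> were outside \<open>B\<close>, then \<open>z\<close>
    would be a polynomial in \<open>1 / s\<close> over \<open>B\<close>, so \<open>s ^ n * z\<close>
    would lie in \<open>B\<close>. As \<open>s ^ n\<close> has the form \<open>1 - w * b'\<close>,
    this element is \<open>z - b'\<close>, which would force \<open>z\<close> into
    \<open>B\<close>.\<close>
  have unit1: "1 - w * b \<noteq> 0" "inverse (1 - w * b) \<in> B" if b: "b \<in> B" for b
  proof -
    show nz: "1 - w * b \<noteq> 0"
    proof
      assume "1 - w * b = 0"
      then have "z * (w * b) = z" by simp
      then have "b = z" using zw by (simp flip: mult.assoc)
      then show False using b zB by simp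
    qed
    define s where "s = 1 - w * b"
    have spow: "\<exists>b'\<in>B. s ^ n = 1 - w * b'" for n
    proof (induction n)
      case 0 show ?case by (intro bexI[of _ 0]) auto
    next
      case (Suc n)
      then obtain b' where b': "b' \<in> B" "s ^ n = 1 - w * b'" by blast
      have "s ^ Suc n = 1 - w * (b + b' + - (w * b * b'))"
        by (simp only: power_Suc b'(2)) (simp add: s_def algebra_simps)
      then show ?case using b b'(1) wB by (blast intro: addB mulB minB)
    qed
    show "inverse (1 - w * b) \<in> B"
    proof (rule ccontr)
      assume "inverse (1 - w * b) \<notin> B"
      then obtain n a where a: "\<And>i. a i \<in> B" "z = (\<Sum>i\<le>n. a i * inverse s ^ i)"
        using ext[of "inverse s"] by (auto simp: s_def)
      have s0: "s \<noteq> 0" using nz by (simp add: s_def)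
      have sB: "s \<in> B" using addB[of 1 "- (w * b)"] b wB by (auto simp: s_def intro: mulB minB)
      have "s ^ n * z = (\<Sum>i\<le>n. a i * s ^ (n - i))"
        unfolding a(2) sum_distrib_left using s0
        by (intro sum.cong) (auto simp: power_diff power_inverse field_simps)
      moreover have "(\<Sum>i\<le>n. a i * s ^ (n - i)) \<in> B"
        using a(1) sB by (intro sumB mulB powB) auto
      ultimately have c: "s ^ n * z \<in> B" by simp
      obtain b' where b': "b' \<in> B" "s ^ n = 1 - w * b'" using spow by blast
      have "s ^ n * z + b' = z" using zw by (simp add: b' algebra_simps)
      then show False using addB[OF c b'(1)] zB by simp
    qed
  qed
  \<comment> \<open>\<open>R u n\<close> puts 1 into \<open>w * B[u]\<close> in degree at most
    \<open>n\<close>; it is the relation from \<open>ext\<close> multiplied by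
    \<open>w\<close>.\<close>
  define R where "R u n \<longleftrightarrow> (\<exists>b. (\<forall>i. b i \<in> B) \<and> (\<Sum>i\<le>n. w * b i * u ^ i) = 1)" for u and n :: nat
  have R_ext: "\<exists>n. R u n" if u: "u \<notin> B" for u
  proof -
    obtain n b where "\<And>i. b i \<in> B" "z = (\<Sum>i\<le>n. b i * u ^ i)" using ext[OF u] by blast
    moreover from this have "(\<Sum>i\<le>n. w * b i * u ^ i) = w * z"
      by (simp add: sum_distrib_left mult_ac)
    ultimately show ?thesis unfolding R_def using zw by (auto simp: mult.commute)
  qed
  have R_0: "\<not> R u 0" for u
  proof
    assume "R u 0"
    then obtain b where b: "b \<in> B" "w * b = 1" by (auto simp: R_def)
    then have "z * (w * b) = z" by simp
    then have "b = z" using zw by (simp flip: mult.assoc)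
    then show False using b zB by simp
  qed
  \<comment> \<open>Dividing the relation in \<open>1 / u\<close> by the unit
    \<open>1 - w * c 0\<close> expresses \<open>u ^ Suc n\<close> through lower powers of
    \<open>u\<close>; substituting this removes the top term of the relation in
    \<open>u\<close>.\<close>
  have R_step: "R u n" if prems: "R u (Suc n)" "R (inverse u) m" "m \<le> Suc n" "u \<noteq> 0" for u n m
  proof -
    obtain b where b: "\<And>i. b i \<in> B" "(\<Sum>i\<le>Suc n. w * b i * u ^ i) = 1"
      using prems(1) unfolding R_def by blast
    obtain c where c: "\<And>i. c i \<in> B" "(\<Sum>i\<le>m. w * c i * inverse u ^ i) = 1"
      using prems(2) unfolding R_def by blast
    define s where "s = inverse (1 - w * c 0)"
    have s: "s \<in> B" "s * (1 - w * c 0) = 1"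
      using unit1[OF c(1)[of 0]] by (auto simp: s_def)
    have "(\<Sum>i<m. w * c (Suc i) * inverse u ^ Suc i) = 1 - w * c 0"
      using c(2) unfolding sum.atMost_shift by (simp add: algebra_simps)
    then have "s * (\<Sum>i<m. w * c (Suc i) * inverse u ^ Suc i) = 1"
      using s(2) by simp
    then have "u ^ Suc n = (\<Sum>i<m. u ^ Suc n * (s * (w * c (Suc i) * inverse u ^ Suc i)))"
      by (simp only: sum_distrib_left[symmetric]) simp
    also have "\<dots> = (\<Sum>i<m. w * s * c (Suc i) * u ^ (n - i))"
    proof (intro sum.cong refl)
      fix i assume "i \<in> {..<m}"
      then have eq: "u ^ Suc n * inverse u ^ Suc i = u ^ (n - i)"
        using that(3,4) power_diff[of u "Suc i" "Suc n"] by (simp add: power_inverse divide_inverse)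
      show "u ^ Suc n * (s * (w * c (Suc i) * inverse u ^ Suc i)) = w * s * c (Suc i) * u ^ (n - i)"
        unfolding eq[symmetric] by (simp only: mult_ac)
    qed
    also have "\<dots> = (\<Sum>i\<in>{Suc n - m..n}. w * s * c (Suc (n - i)) * u ^ i)"
      using that(3) by (intro sum.reindex_bij_witness[of _ "\<lambda>i. n - i" "\<lambda>i. n - i"]) auto
    also have "\<dots> = (\<Sum>i\<le>n. (if Suc n - m \<le> i then w * s * c (Suc (n - i)) else 0) * u ^ i)"
      by (intro sum.mono_neutral_cong_left) auto
    finally have un: "u ^ Suc n = \<dots>" .
    define b' where "b' i = b i + b (Suc n) * (if Suc n - m \<le> i then w * s * c (Suc (n - i)) else 0)" for i
    have "(\<Sum>i\<le>n. w * b' i * u ^ i) = (\<Sum>i\<le>n. w * b i * u ^ i) + w * b (Suc n) * u ^ Suc n"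
      unfolding un by (simp add: b'_def sum_distrib_left sum.distrib algebra_simps del: power_Suc)
    also have "\<dots> = 1" using b(2) by simp
    finally have "(\<Sum>i\<le>n. w * b' i * u ^ i) = 1" .
    moreover have "b' i \<in> B" for i
      using b(1) c(1) s(1) wB by (auto simp: b'_def intro!: addB mulB)
    ultimately show ?thesis unfolding R_def by blast
  qed
  \<comment> \<open>Descent: the relation of larger degree is shortened by the other one until a
    degree reaches 0, which \<open>R_0\<close> excludes.\<close>
  have R_False: "False" if "R u n" "R (inverse u) m" "u \<noteq> 0" for u n m
    using that
  proof (induction "n + m" arbitrary: u n m rule: less_induct)
    case less
    obtain n' m' where nm: "n = Suc n'" "m = Suc m'"
      using R_0 less.prems(1,2) by (metis nat.exhaust)
    show False
    proof (cases "m \<le> n")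
      case True
      then have "R u n'" using R_step[of u n' m] less.prems nm by auto
      then show False using less.hyps[of n' m u] less.prems nm by auto
    next
      case False
      then have "R (inverse u) m'" using R_step[of "inverse u" m' n] less.prems nm by auto
      then show False using less.hyps[of n m' u] less.prems nm by auto
    qed
  qed
  have valB: "u \<in> B \<or> inverse u \<in> B" for u
    using R_ext[of u] R_ext[of "inverse u"] R_False[of u] by (cases "u = 0") auto
  \<comment> \<open>The nonunits of \<open>B\<close>; zero is listed separately because
    \<open>inverse 0 = 0\<close> lies in \<open>B\<close>.\<close>
  define m where "m = {f \<in> B. f = 0 \<or> inverse f \<notin> B}"
  have mB: "f \<in> m \<Longrightarrow> f \<in> B" for f by (simp add: m_def)
  have m_mult: "a * f \<in> m" if "a \<in> B" "f \<in> m" for a f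
  proof (cases "a * f = 0")
    case False
    then have eq: "a * inverse (a * f) = inverse f" by (simp add: field_simps)
    have "inverse (a * f) \<notin> B"
      using mulB[OF that(1), of "inverse (a * f)"] that(2) False unfolding eq by (auto simp: m_def)
    then show ?thesis using mulB[OF that(1) mB[OF that(2)]]
      by (simp add: m_def del: inverse_mult_distrib)
  qed (auto simp: m_def)
  have m_add_aux: "f + g \<in> m" if "f \<in> m" "g \<in> m" "f * inverse g \<in> B" "g \<noteq> 0" for f g
  proof -
    have "f + g = (f * inverse g + 1) * g" using that by (simp add: field_simps)
    then show ?thesis using that m_mult[of "f * inverse g + 1" g] addB by auto
  qed
  have m_add: "f + g \<in> m" if "f \<in> m" "g \<in> m" for f g
  proof (cases "f = 0 \<or> g = 0")
    case False
    then show ?thesis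
      using m_add_aux[of f g] m_add_aux[of g f] that valB[of "f * inverse g"]
      by (auto simp: add.commute mult.commute)
  qed (use that in auto)
  have m_0: "0 \<in> m" by (simp add: m_def)
  have m_sum: "sum f J \<in> m" if "\<And>j. j \<in> J \<Longrightarrow> f j \<in> m" for f and J :: "nat set"
    using that by (induction J rule: infinite_finite_induct) (auto intro: m_add m_0)
  have wm: "w \<in> m" using wB zB by (simp add: m_def inv_w)
  have unit_not_m: "c \<notin> m" if "c \<in> K" "c \<noteq> 0" for c
    using that KB[of "inverse c"] by (auto simp: m_def)
  have m_minus: "- f \<in> m" if "f \<in> m" for f
    using m_mult[of "- 1" f] KB[of "- 1"] that by auto
  have dominant: False
    if "c \<in> K" "c \<noteq> 0" "f \<in> m" "c + f = 0" for c f
    using unit_not_m[OF that(1,2)] m_minus[OF that(3)] that(4) by (metis add_eq_0_iff2)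
  \<comment> \<open>Without a generator, every nonzero nonunit is a product of two nonunits. This
    yields an infinite sequence \<open>g\<close> from \<open>w\<close> in which each member is a
    nonunit multiple of the next. In a relation over \<open>K[w]\<close> among them, take the last
    \<open>l\<close> with \<open>c l \<noteq> 0\<close>: after division by its function, everything
    except the unit \<open>c l\<close> is a nonunit.\<close>
  have "\<exists>t\<in>m. t \<noteq> 0 \<and> (\<forall>f\<in>m. f * inverse t \<in> B)"
  proof (rule ccontr)
    assume neg: "\<not> ?thesis"
    have "\<exists>f. f \<in> m \<and> f \<noteq> 0 \<and> t * inverse f \<in> m" if t: "t \<in> m" "t \<noteq> 0" for t
    proof -
      obtain f where f: "f \<in> m" "f * inverse t \<notin> B" using neg t by blast
      then have "f \<noteq> 0" by auto
      moreover have "t * inverse f \<in> m"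
        using valB[of "f * inverse t"] f(2) t(2) \<open>f \<noteq> 0\<close> by (auto simp: m_def mult.commute)
      ultimately show ?thesis using f(1) by blast
    qed
    then obtain nxt where nxt: "\<And>t. t \<in> m \<Longrightarrow> t \<noteq> 0 \<Longrightarrow> nxt t \<in> m \<and> nxt t \<noteq> 0 \<and> t * inverse (nxt t) \<in> m"
      by metis
    define g where "g k = (nxt ^^ k) w" for k
    have g: "g k \<in> m \<and> g k \<noteq> 0" for k
      by (induction k) (use wm w0 nxt in \<open>auto simp: g_def\<close>)
    have g_step: "g k * inverse (g (Suc k)) \<in> m" for k
      using nxt[of "g k"] g[of k] by (simp add: g_def)
    have g_less: "g k * inverse (g k') \<in> m" if "k < k'" for k k'
      using that
    proof (induction k')
      case (Suc k')
      show ?case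
      proof (cases "k = k'")
        case False
        then have "g k * inverse (g k') \<in> m" using Suc by auto
        then have "(g k * inverse (g k')) * (g k' * inverse (g (Suc k'))) \<in> m"
          using g_step m_mult mB by blast
        then show ?thesis using g[of k'] by (simp add: field_simps)
      qed (use g_step in simp)
    qed simp
    \<comment> \<open>The index starts at 1 so that \<open>w = g 0\<close> is a nonunit multiple of
      every member.\<close>
    obtain M where "dependent w (\<lambda>j. g (Suc j)) M"
      using dependent_large[of w] by blast
    then obtain c r where cr: "\<And>j. c j \<in> K" "\<And>j. r j \<in> adjoin w" "\<exists>j. j < M \<and> c j \<noteq> 0"
      "(\<Sum>j<M. (c j + w * r j) * g (Suc j)) = 0"
      by (rule dependent_normal[OF w0]) blast
    define l where "l = Max {j. j < M \<and> c j \<noteq> 0}"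
    have l: "l < M" "c l \<noteq> 0"
      using Max_in[of "{j. j < M \<and> c j \<noteq> 0}"] cr(3) by (auto simp: l_def)
    have above: "c j = 0" if "l < j" "j < M" for j
      using Max_ge[of "{j. j < M \<and> c j \<noteq> 0}" j] that
      by (auto simp: l_def[symmetric])
    define G where "G = inverse (g (Suc l))"
    have rB: "r j \<in> B" for j using adjB cr(2) wB by blast
    have gB: "g j \<in> B" for j using g mB by blast
    have wG: "w * G \<in> m" using g_less[of 0 "Suc l"] by (simp add: g_def G_def)
    have wrG: "w * r j * g (Suc j) * G \<in> m" for j
      using m_mult[OF mulB[OF rB[of j] gB[of "Suc j"]] wG] by (simp add: mult_ac)
    have rest: "(c j + w * r j) * g (Suc j) * G \<in> m" if "j \<in> {..<M} - {l}" for j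
    proof -
      have "c j * (g (Suc j) * G) \<in> m"
      proof (cases "j < l")
        case True
        then show ?thesis using m_mult g_less[of "Suc j" "Suc l"] KB cr(1) by (simp add: G_def)
      next
        case False
        then have "c j = 0" using above that by auto
        then show ?thesis by (simp add: m_def)
      qed
      from m_add[OF this wrG[of j]] show ?thesis by (simp add: algebra_simps)
    qed
    have "(\<Sum>j<M. (c j + w * r j) * g (Suc j) * G) = 0"
      using cr(4) by (simp flip: sum_distrib_right)
    then have "(c l + w * r l) * g (Suc l) * G + (\<Sum>j\<in>{..<M} - {l}. (c j + w * r j) * g (Suc j) * G) = 0"
      using l(1) by (subst (asm) sum.remove[of _ l]) auto
    moreover have "(c l + w * r l) * g (Suc l) * G = c l + w * r l"
      using g[of "Suc l"] by (simp add: G_def)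
    ultimately have "c l + (w * r l + (\<Sum>j\<in>{..<M} - {l}. (c j + w * r j) * g (Suc j) * G)) = 0"
      by (simp add: add.assoc)
    moreover have "w * r l + (\<Sum>j\<in>{..<M} - {l}. (c j + w * r j) * g (Suc j) * G) \<in> m"
      using m_mult[OF rB wm, of l] rest by (intro m_add m_sum) (auto simp: mult.commute)
    ultimately show False using dominant[of "c l"] cr(1) l(2) by blast
  qed
  then obtain t where t: "t \<in> m" "t \<noteq> 0" "\<And>f. f \<in> m \<Longrightarrow> f * inverse t \<in> B" by blast
  have tB: "t \<in> B" using t mB by blast
  \<comment> \<open>If all powers of \<open>t\<close> divided \<open>u\<close>, take a relation over
    \<open>K[u]\<close> among the powers of \<open>t\<close> and the least \<open>l\<close> with
    \<open>c l \<noteq> 0\<close>. Divided by \<open>t ^ l\<close>, everything except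
    \<open>c l\<close> would be a nonunit.\<close>
  have bounded: "\<exists>n. u * inverse (t ^ n) \<notin> B" if u: "u \<in> B" "u \<noteq> 0" for u
  proof (rule ccontr)
    assume "\<not> ?thesis"
    then have all: "u * inverse (t ^ n) \<in> B" for n by blast
    have um: "u * inverse (t ^ n) \<in> m" for n
      using m_mult[OF all[of "Suc n"] t(1)] t(2) by (simp add: field_simps)
    obtain M where "dependent u (\<lambda>j. t ^ j) M"
      using dependent_large[of u] by blast
    then obtain c r where cr: "\<And>j. c j \<in> K" "\<And>j. r j \<in> adjoin u" "\<exists>j. j < M \<and> c j \<noteq> 0"
      "(\<Sum>j<M. (c j + u * r j) * t ^ j) = 0"
      by (rule dependent_normal[OF u(2)]) blast
    define l where "l = (LEAST j. j < M \<and> c j \<noteq> 0)"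
    have l: "l < M" "c l \<noteq> 0"
      using LeastI_ex[OF cr(3)] by (auto simp: l_def)
    have below: "c j = 0" if "j < l" "j < M" for j
      using not_less_Least[OF that(1)[unfolded l_def]] that by auto
    define G where "G = inverse (t ^ l)"
    have rB: "r j \<in> B" for j using adjB cr(2) u(1) by blast
    have urG: "u * r j * t ^ j * G \<in> m" for j
      using m_mult[OF mulB[OF rB[of j] powB[OF tB, of j]] um[of l]] by (simp add: mult_ac G_def)
    have rest: "(c j + u * r j) * t ^ j * G \<in> m" if "j \<in> {..<M} - {l}" for j
    proof -
      have "c j * (t ^ j * G) \<in> m"
      proof (cases "l < j")
        case True
        then obtain d where "j = l + Suc d" by (auto simp: less_iff_Suc_add)
        then have "t ^ j * G = t ^ d * t"
          using t(2) by (simp add: G_def power_add)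
        then show ?thesis using m_mult[OF powB[OF tB, of d] t(1)] m_mult KB cr(1) by metis
      next
        case False
        then have "c j = 0" using below that by auto
        then show ?thesis by (simp add: m_def)
      qed
      from m_add[OF this urG[of j]] show ?thesis by (simp add: algebra_simps)
    qed
    have "(\<Sum>j<M. (c j + u * r j) * t ^ j * G) = 0"
      using cr(4) by (simp flip: sum_distrib_right)
    then have "(c l + u * r l) * t ^ l * G + (\<Sum>j\<in>{..<M} - {l}. (c j + u * r j) * t ^ j * G) = 0"
      using l(1) by (subst (asm) sum.remove[of _ l]) auto
    moreover have "(c l + u * r l) * t ^ l * G = c l + u * r l"
      using t(2) by (simp add: G_def)
    ultimately have "c l + (u * r l + (\<Sum>j\<in>{..<M} - {l}. (c j + u * r j) * t ^ j * G)) = 0"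
      by (simp add: add.assoc)
    moreover have "u * r l + (\<Sum>j\<in>{..<M} - {l}. (c j + u * r j) * t ^ j * G) \<in> m"
      using m_mult[OF rB um[of 0], of l] rest by (intro m_add m_sum) (auto simp: mult.commute)
    ultimately show False using dominant[of "c l"] cr(1) l(2) by blast
  qed
  define U where "U f \<longleftrightarrow> f \<noteq> 0 \<and> f \<in> B \<and> inverse f \<in> B" for f
  have U_mult: "U (f * g)" if "U f" "U g" for f g
    using that mulB by (auto simp: U_def)
  have U_inverse: "U (inverse f)" if "U f" for f
    using that by (auto simp: U_def)
  \<comment> \<open>At the first \<open>n\<close> with \<open>u / t ^ n\<close> outside
    \<open>B\<close>, the previous quotient lies in \<open>B\<close> but is not divisible by
    \<open>t\<close>, hence is a unit.\<close>
  have exB: "\<exists>n. U (u * inverse (t ^ n))" if u: "u \<in> B" "u \<noteq> 0" for u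
  proof -
    obtain n where n: "u * inverse (t ^ n) \<notin> B"
      "\<And>k. k < n \<Longrightarrow> u * inverse (t ^ k) \<in> B"
      using exists_least_iff[of "\<lambda>n. u * inverse (t ^ n) \<notin> B"] bounded[OF u] by blast
    obtain k where k: "n = Suc k" using n(1) u(1) by (cases n) auto
    have "u * inverse (t ^ k) * inverse t \<notin> B" using n(1) k by (simp add: mult_ac)
    then have "u * inverse (t ^ k) \<notin> m" using t(3) by blast
    then have "U (u * inverse (t ^ k))" using n(2)[of k] k u(2) t(2) by (simp add: U_def m_def)
    then show ?thesis by blast
  qed
  have ex: "\<exists>k. U (u * t powi (- k))" if u: "u \<noteq> 0" for u
  proof (cases "u \<in> B")
    case True
    then obtain n where "U (u * inverse (t ^ n))" using exB u by blast
    then show ?thesis by (intro exI[of _ "int n"]) (simp add: power_int_minus)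
  next
    case False
    then have "inverse u \<in> B" using valB by blast
    then obtain n where "U (inverse u * inverse (t ^ n))" using exB[of "inverse u"] u by auto
    then have "U (inverse (inverse u * inverse (t ^ n)))" by (rule U_inverse)
    then show ?thesis by (intro exI[of _ "- int n"]) simp
  qed
  have tpow_m: "t powi k \<in> m" if "k > 0" for k
  proof -
    have "t powi k = t ^ (nat k - 1) * t"
      using that by (simp add: power_int_def flip: power_Suc2)
    then show ?thesis using m_mult[OF powB[OF tB] t(1)] by metis
  qed
  have tpow_B: "t powi k \<in> B" if "k \<ge> 0" for k
    using that powB[OF tB] by (simp add: power_int_def)
  have U_not_m: "f \<notin> m" if "U f" for f using that by (auto simp: U_def m_def)
  have tpow_U: "k = 0" if "U (t powi k)" for k
  proof (rule ccontr)
    assume "k \<noteq> 0"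
    then consider "k > 0" | "- k > 0" by linarith
    then show False
    proof cases
      case 1
      then show False using tpow_m U_not_m that by blast
    next
      case 2
      have "U (t powi (- k))" using U_inverse[OF that] by (simp add: power_int_minus)
      then show False using tpow_m[OF 2] U_not_m by blast
    qed
  qed
  have uniq: "k = l" if "U (u * t powi (- k))" "U (u * t powi (- l))" "u \<noteq> 0" for u k l
  proof -
    have "U (u * t powi (- k) * inverse (u * t powi (- l)))"
      using that U_mult U_inverse by blast
    also have "u * t powi (- k) * inverse (u * t powi (- l)) = t powi (l - k)"
      using t(2) that(3) by (simp add: power_int_minus power_int_diff field_simps)
    finally show ?thesis using tpow_U[of "l - k"] by simp
  qed
  \<comment> \<open>\<open>ex\<close> and \<open>uniq\<close> justify the definite description; the
    value at 0 is the dummy that \<open>closed_points\<close> prescribes.\<close>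
  define v where "v u = (if u = 0 then 0 else THE k. U (u * t powi (- k)))" for u
  have v_eq: "v u = k" if "U (u * t powi (- k))" "u \<noteq> 0" for u k
    unfolding v_def using that uniq by (auto intro!: the_equality)
  have v_U: "U (u * t powi (- v u))" if "u \<noteq> 0" for u
    using ex[OF that] v_eq that by metis
  have v_ge: "u * t powi (- k) \<in> B" if "u \<noteq> 0" "k \<le> v u" for u k
  proof -
    have "u * t powi (- k) = u * t powi (- v u) * t powi (v u - k)"
      using t(2) by (simp add: mult.assoc flip: power_int_add)
    moreover have "u * t powi (- v u) \<in> B" using v_U[OF that(1)] by (simp add: U_def)
    ultimately show ?thesis using tpow_B[of "v u - k"] that(2) mulB by (metis diff_ge_0_iff_ge)
  qed
  have "v \<in> closed_points K"
    unfolding closed_points_def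
  proof (intro CollectI conjI allI impI ballI)
    show "v 0 = 0" by (simp add: v_def)
    show "v (f * g) = v f + v g" if "f \<noteq> 0 \<and> g \<noteq> 0" for f g
    proof (rule v_eq)
      have "U ((f * t powi (- v f)) * (g * t powi (- v g)))"
        using that v_U U_mult by blast
      also have "(f * t powi (- v f)) * (g * t powi (- v g)) = f * g * t powi (- (v f + v g))"
        using power_int_add[of t "- v f" "- v g"] t(2) by (simp add: mult_ac)
      finally show "U (f * g * t powi (- (v f + v g)))" .
    qed (use that in simp)
    show "min (v f) (v g) \<le> v (f + g)" if fg: "f \<noteq> 0 \<and> g \<noteq> 0 \<and> f + g \<noteq> 0" for f g
    proof (rule ccontr)
      define k where "k = min (v f) (v g)"
      assume "\<not> min (v f) (v g) \<le> v (f + g)"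
      then have less: "v (f + g) < k" unfolding k_def by (simp only: not_le)
      have "f * t powi (- k) + g * t powi (- k) \<in> B"
        using fg by (intro addB v_ge) (auto simp: k_def)
      then have "(f * t powi (- k) + g * t powi (- k)) * t powi (k - v (f + g)) \<in> m"
        using less by (intro m_mult tpow_m) auto
      also have "(f * t powi (- k) + g * t powi (- k)) * t powi (k - v (f + g))
          = (f + g) * (t powi (- k) * t powi (k - v (f + g)))"
        by (simp add: algebra_simps)
      also have "t powi (- k) * t powi (k - v (f + g)) = t powi (- v (f + g))"
        using t(2) by (simp flip: power_int_add)
      finally show False using v_U[of "f + g"] U_not_m fg by blast
    qed
    show "v c = 0" if "c \<in> K" "c \<noteq> 0" for c
      using that KB by (intro v_eq) (auto simp: U_def)
    show "\<exists>t. t \<noteq> 0 \<and> v t = 1"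
      using t(2) by (intro exI[of _ t] conjI v_eq) (auto simp: U_def power_int_minus)
  qed
  moreover have "v z < 0"
  proof (rule ccontr)
    assume "\<not> v z < 0"
    then have "z * t powi (- 0) \<in> B" using z0 by (intro v_ge) auto
    then show False using zB by simp
  qed
  ultimately show ?thesis by blast
qed

end

section \<open>Weak approximation and finiteness of zeros and poles\<close>

context constant_field
begin

text \<open>If regularity at \<open>v\<close> implied regularity at \<open>v'\<close>, units at
  \<open>v\<close> would be units at \<open>v'\<close>, and \<open>v'\<close> would be
  \<open>v' t\<close> times \<open>v\<close> for a uniformizer \<open>t\<close> at \<open>v\<close>.
  Since both are normalized, this positive integer factor is 1, and the two points coincide.\<close>

lemma valuations_incomparable:
  assumes v: "v \<in> closed_points K" and v': "v' \<in> closed_points K" and ne: "v \<noteq> v'"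
  shows "\<exists>a. a \<noteq> 0 \<and> 0 \<le> v a \<and> v' a < 0"
proof (rule ccontr)
  assume "\<not> ?thesis"
  then have dom: "0 \<le> v' a" if "a \<noteq> 0" "0 \<le> v a" for a
    using that by force
  have unit: "v' a = 0" if "a \<noteq> 0" "v a = 0" for a
    using dom[of a] dom[of "inverse a"] that by (simp add: val_inverse[OF v] val_inverse[OF v'])
  obtain t where t: "t \<noteq> 0" "v t = 1" using val_uniformizer[OF v] by blast
  have scale: "v' f = v f * v' t" if f: "f \<noteq> 0" for f
  proof -
    have nz: "t powi (- v f) \<noteq> 0" using t(1) by simp
    have "v (f * t powi (- v f)) = 0"
      using val_mult[OF v f nz] t by (simp add: val_powi[OF v])
    then have "v' (f * t powi (- v f)) = 0" using f t(1) by (intro unit) auto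
    then show ?thesis using val_mult[OF v' f nz] t(1) by (simp add: val_powi[OF v'])
  qed
  obtain s where s: "s \<noteq> 0" "v' s = 1" using val_uniformizer[OF v'] by blast
  have one: "v' t * v s = 1" using scale[OF s(1)] s(2) by (simp add: mult.commute)
  then have "v' t \<noteq> 0" by auto
  then have "0 < v' t" using dom[of t] t by simp
  then have "v' t = 1" using one pos_zmult_eq_1_iff by blast
  then have "v f = v' f" for f
    using scale[of f] val_const[OF v, of 0] val_const[OF v', of 0] by (cases "f = 0") auto
  then show False using ne by auto
qed

lemma weak_separation:
  assumes v: "v \<in> closed_points K" and v': "v' \<in> closed_points K" and ne: "v \<noteq> v'"
  obtains a where "a \<noteq> 0" "v a < 0" "0 < v' a"
proof -
  obtain a where a: "a \<noteq> 0" "0 \<le> v a" "v' a < 0" using valuations_incomparable[OF v v' ne] by blast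
  obtain b where b: "b \<noteq> 0" "0 \<le> v' b" "v b < 0"
    using valuations_incomparable[OF v' v] ne by blast
  show ?thesis
    by (rule that[of "b / a"]) (use a b in \<open>auto simp: val_divide[OF v] val_divide[OF v']\<close>)
qed

text \<open>Induction on \<open>T\<close>; \<open>w\<close> has a pole at \<open>v\<close> and a
  zero at the new point \<open>u\<close>. If \<open>s\<close> is a unit at \<open>u\<close>, take
  \<open>w * s ^ m\<close>. If \<open>s\<close> has a pole at \<open>u\<close>, replace the factor
  by \<open>s ^ m / (1 + s ^ m)\<close>, which is a unit at the poles of \<open>s\<close> and has
  the order of \<open>s ^ m\<close> at its zeros.\<close>

lemma separation_finite:
  assumes v: "v \<in> closed_points K" and T: "finite T" "T \<subseteq> closed_points K" "v \<notin> T"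
  shows "\<exists>s. s \<noteq> 0 \<and> v s < 0 \<and> (\<forall>v'\<in>T. 0 < v' s)"
  using T
proof (induction T rule: finite_induct)
  case empty
  obtain t where "t \<noteq> 0" "v t = 1" using val_uniformizer[OF v] by blast
  then show ?case by (intro exI[of _ "inverse t"]) (auto simp: val_inverse[OF v])
next
  case (insert u T)
  then obtain s where s: "s \<noteq> 0" "v s < 0" "\<And>v'. v' \<in> T \<Longrightarrow> 0 < v' s" by auto
  have u: "u \<in> closed_points K" and cp: "\<And>v'. v' \<in> T \<Longrightarrow> v' \<in> closed_points K"
    using insert by auto
  obtain w where w: "w \<noteq> 0" "v w < 0" "0 < u w"
    using weak_separation[OF v u] insert.prems by auto
  \<comment> \<open>Large enough for \<open>s ^ m\<close> to outweigh a pole of \<open>w\<close> at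
    any point of \<open>T\<close>.\<close>
  define m where "m = Suc (nat (\<Sum>v'\<in>T. \<bar>v' w\<bar>))"
  have m: "0 < v' w + int m * v' s" if "v' \<in> T" for v'
  proof -
    have "\<bar>v' w\<bar> \<le> (\<Sum>v'\<in>T. \<bar>v' w\<bar>)" using that insert.hyps by (intro member_le_sum) auto
    then have "\<bar>v' w\<bar> < int m" by (simp add: m_def)
    moreover have "int m * 1 \<le> int m * v' s" using s(3)[OF that] by (intro mult_left_mono) auto
    ultimately show ?thesis by linarith
  qed
  consider "0 < u s" | "u s = 0" | "u s < 0" by linarith
  then show ?case
  proof cases
    case 1
    then show ?thesis using s by auto
  next
    case 2
    have "v (w * s ^ m) < 0"
      using s w val_mult[OF v, of w "s ^ m"] by (simp add: val_power[OF v] add_neg_nonpos mult_nonneg_nonpos)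
    moreover have "0 < u (w * s ^ m)"
      using s w 2 val_mult[OF u, of w "s ^ m"] by (simp add: val_power[OF u])
    moreover have "0 < v' (w * s ^ m)" if "v' \<in> T" for v'
      using s w m[OF that] val_mult[OF cp[OF that], of w "s ^ m"] by (simp add: val_power[OF cp[OF that]])
    ultimately show ?thesis using s w by (intro exI[of _ "w * s ^ m"]) auto
  next
    case 3
    have m0: "m > 0" by (simp add: m_def)
    have neg: "v' (s ^ m / (1 + s ^ m)) = 0 \<and> 1 + s ^ m \<noteq> 0"
      if "v' \<in> closed_points K" "v' s < 0" for v'
    proof -
      have "v' (s ^ m) < 0" using that s(1) m0 by (simp add: val_power mult_pos_neg)
      then have "s ^ m + 1 \<noteq> 0" "v' (s ^ m + 1) = v' (s ^ m)"
        using val_add_dominant[OF that(1), of "s ^ m" 1] s(1) val_one[OF that(1)] by (auto simp: vge_def)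
      then show ?thesis using val_divide[OF that(1), of "s ^ m" "1 + s ^ m"] s(1) by (simp add: add.commute)
    qed
    have nz: "1 + s ^ m \<noteq> 0" using neg[OF v s(2)] by simp
    define q where "q = s ^ m / (1 + s ^ m)"
    have q0: "q \<noteq> 0" using nz s(1) by (simp add: q_def)
    let ?f = "w * q"
    have "v ?f < 0" using val_mult[OF v w(1) q0] neg[OF v s(2)] w by (simp add: q_def)
    moreover have "0 < u ?f" using val_mult[OF u w(1) q0] neg[OF u 3] w by (simp add: q_def)
    moreover have "0 < v' ?f" if v': "v' \<in> T" for v'
    proof -
      have "v' (s ^ m) > 0" using s v' m0 by (simp add: val_power[OF cp])
      then have "v' (1 + s ^ m) = 0" using val_const_add[OF cp[OF v'], of 1 "s ^ m"] by (simp add: vge_def)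
      then have "v' ?f = v' w + int m * v' s"
        using val_mult[OF cp[OF v'] w(1) q0] val_divide[OF cp[OF v'], of "s ^ m" "1 + s ^ m"]
          nz s(1) by (simp add: q_def val_power[OF cp[OF v']])
      then show ?thesis using m[OF v'] by simp
    qed
    ultimately show ?thesis using w q0 by (intro exI[of _ ?f]) auto
  qed
qed

text \<open>With \<open>s\<close> from \<open>separation_finite\<close>, the function
  \<open>s ^ m / (1 + s ^ m)\<close> is close to 1 at the pole \<open>v\<close> of \<open>s\<close>
  and close to 0 at the zeros of \<open>s\<close> in \<open>T\<close>.\<close>

lemma weak_approximation:
  assumes v: "v \<in> closed_points K" and T: "finite T" "T \<subseteq> closed_points K" "v \<notin> T"
  obtains t where "t \<noteq> 0" "v t = 0" "vge v (int k) (1 - t)" "\<And>v'. v' \<in> T \<Longrightarrow> int k \<le> v' t"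
proof -
  obtain s where s: "s \<noteq> 0" "v s < 0" "\<And>v'. v' \<in> T \<Longrightarrow> 0 < v' s"
    using separation_finite[OF assms] by blast
  \<comment> \<open>One more than \<open>k\<close>, so that \<open>s ^ m\<close> has a pole at
    \<open>v\<close> and zeros on \<open>T\<close> also for \<open>k = 0\<close>.\<close>
  define m where "m = Suc k"
  have cp: "v' \<in> closed_points K" if "v' \<in> T" for v' using T that by auto
  have pow: "v (s ^ m) = int m * v s" using s by (simp add: val_power[OF v])
  have neg: "v (s ^ m) < 0" unfolding pow using s(2) by (simp add: m_def mult_pos_neg)
  have nz: "1 + s ^ m \<noteq> 0" and vs: "v (1 + s ^ m) = v (s ^ m)"
    using val_add_dominant[OF v, of "s ^ m" 1] neg s(1) val_one[OF v]
    by (auto simp: vge_def add.commute)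
  have compl: "1 - s ^ m / (1 + s ^ m) = inverse (1 + s ^ m)"
    using nz by (simp add: field_simps)
  have "int m * v s \<le> int m * (- 1)" using s(2) by (intro mult_left_mono) auto
  then have 1: "vge v (int k) (1 - s ^ m / (1 + s ^ m))"
    unfolding compl using vs pow by (simp add: vge_def val_inverse[OF v] m_def)
  have 2: "int k \<le> v' (s ^ m / (1 + s ^ m))" if v': "v' \<in> T" for v'
  proof -
    have pow': "v' (s ^ m) = int m * v' s" using s by (simp add: val_power[OF cp[OF v']])
    have ge: "int m * 1 \<le> int m * v' s" using s(3)[OF v'] by (intro mult_left_mono) auto
    have "1 \<le> int m" by (simp add: m_def)
    then have "vge v' 1 (s ^ m)" using ge unfolding vge_def pow' by linarith
    then have "v' (1 + s ^ m) = 0"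
      using val_const_add[OF cp[OF v'], of 1 "s ^ m"] by simp
    then have "v' (s ^ m / (1 + s ^ m)) = int m * v' s"
      using val_divide[OF cp[OF v'], of "s ^ m" "1 + s ^ m"] nz s(1) pow' by simp
    moreover have "int k \<le> int m * 1" by (simp add: m_def)
    ultimately show ?thesis using ge by linarith
  qed
  have 3: "v (s ^ m / (1 + s ^ m)) = 0" using val_divide[OF v, of "s ^ m" "1 + s ^ m"] nz s(1) vs by simp
  show ?thesis by (rule that[of "s ^ m / (1 + s ^ m)"]) (use nz s(1) 1 2 3 in auto)
qed

lemma dependent_modulo:
  assumes "dependent y g m" "y \<noteq> 0"
  obtains c r where "\<And>j. c j \<in> K" "\<And>j. r j \<in> adjoin y" "\<exists>j<m. c j \<noteq> 0"
    "(\<Sum>j<m. c j * g j) = y * (\<Sum>j<m. r j * g j)"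
proof -
  obtain c r where cr: "\<And>j. c j \<in> K" "\<And>j. r j \<in> adjoin y" "\<exists>j<m. c j \<noteq> 0"
    "(\<Sum>j<m. (c j + y * r j) * g j) = 0"
    using dependent_normal[OF assms(2,1)] by blast
  have "(\<Sum>j<m. c j * g j) + y * (\<Sum>j<m. r j * g j) = 0"
    using cr(4) by (simp add: distrib_right sum.distrib sum_distrib_left mult.assoc)
  then show ?thesis using that[of c "\<lambda>j. - r j"] cr adjoin_uminus
    by (simp add: sum_negf eq_neg_iff_add_eq_0)
qed

end

context function_field
begin

text \<open>At \<open>M\<close> distinct zeros of \<open>y\<close>, choose functions that are units
  at one of them and vanish at the others. A relation over \<open>K[y]\<close> among these
  functions, read at the zero \<open>e i\<close> with \<open>c i \<noteq> 0\<close>, would have a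
  single term of order 0 and all others of positive order.\<close>

lemma finite_zeros: "finite {v \<in> closed_points K. 0 < v y}"
proof (cases "y = 0")
  case True
  have "\<not> 0 < v y" if "v \<in> closed_points K" for v
    using val_const[OF that zero_in_K] True by simp
  then have "{v \<in> closed_points K. 0 < v y} = {}" by blast
  then show ?thesis by (simp only: finite.emptyI)
next
  case y: False
  obtain M where M: "\<And>g. dependent y g M" using dependent_large[of y] by blast
  show ?thesis
  proof (rule ccontr)
    assume "infinite {v \<in> closed_points K. 0 < v y}"
    then obtain T where T: "T \<subseteq> {v \<in> closed_points K. 0 < v y}" "card T = M" "finite T"
      using infinite_arbitrarily_large by blast
    obtain e where e: "bij_betw e {..<M} T"
      using ex_bij_betw_nat_finite[OF T(3)] T(2) by (auto simp: atLeast0LessThan)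
    have eT: "e j \<in> T" "e j \<in> closed_points K" "0 < e j y" if "j < M" for j
      using e that T(1) by (auto simp: bij_betw_def)
    have "\<exists>t. t \<noteq> 0 \<and> e j t = 0 \<and> (\<forall>v'\<in>T - {e j}. 1 \<le> v' t)" if j: "j < M" for j
    proof -
      have T': "finite (T - {e j})" "T - {e j} \<subseteq> closed_points K" "e j \<notin> T - {e j}" using T by auto
      show ?thesis
        by (rule weak_approximation[OF eT(2)[OF j] T', where k = 1]) auto
    qed
    then obtain t where t: "\<And>j. j < M \<Longrightarrow> t j \<noteq> 0 \<and> e j (t j) = 0 \<and> (\<forall>v'\<in>T - {e j}. 1 \<le> v' (t j))"
      by metis
    obtain c r where cr: "\<And>j. c j \<in> K" "\<And>j. r j \<in> adjoin y" "\<exists>j<M. c j \<noteq> 0"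
      "(\<Sum>j<M. c j * t j) = y * (\<Sum>j<M. r j * t j)"
      using dependent_modulo[OF M y] by blast
    then obtain i where i: "i < M" "c i \<noteq> 0" by blast
    have ei: "e i \<in> closed_points K" by (rule eT[OF i(1)])
    have ti: "vge (e i) (if j = i then 0 else 1) (t j)" if "j < M" for j
      using t[OF that] eT[OF i(1)] e i(1) that by (auto simp: vge_def bij_betw_def inj_on_def)
    have ti1: "vge (e i) 1 (t j)" if "j \<in> {..<M} - {i}" for j
      using ti[of j] that by auto
    have ti0: "vge (e i) 0 (t j)" if "j < M" for j
      using ti[OF that] by (rule vge_mono) simp
    have y1: "vge (e i) 1 y" using eT(3)[OF i(1)] by (simp add: vge_def)
    have "vge (e i) (1 + 0) (y * (\<Sum>j<M. r j * t j))"
      using y1 by (intro vge_mult[OF ei] vge_sum[OF ei] vge_mult_nonneg[OF ei] vge_adjoin[OF ei cr(2)] ti0)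
        (auto intro: vge_mono[OF y1])
    moreover have "vge (e i) 1 (\<Sum>j\<in>{..<M} - {i}. c j * t j)"
      using ti1 by (intro vge_sum[OF ei] vge_const_mult[OF ei cr(1)])
    ultimately have "vge (e i) 1 ((\<Sum>j<M. c j * t j) - (\<Sum>j\<in>{..<M} - {i}. c j * t j))"
      unfolding cr(4) by (intro vge_diff[OF ei]) simp_all
    moreover have "(\<Sum>j<M. c j * t j) = c i * t i + (\<Sum>j\<in>{..<M} - {i}. c j * t j)"
      using i(1) by (intro sum.remove) auto
    ultimately have "vge (e i) 1 (c i * t i)" by simp
    then show False using i t[OF i(1)] val_mult[OF ei, of "c i" "t i"] val_const[OF ei cr(1)]
      by (auto simp: vge_def)
  qed
qed

lemma finite_poles: "finite {v \<in> closed_points K. v f < 0}"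
proof -
  have "{v \<in> closed_points K. v f < 0} = {v \<in> closed_points K. 0 < v (inverse f)}"
    by (auto simp: val_inverse)
  then show ?thesis using finite_zeros[of "inverse f"] by simp
qed

end

section \<open>Functions with a single pole\<close>

lemma pigeonhole_fiber:
  assumes "finite A" "finite B" "f ` A \<subseteq> B" "k * card B < card A"
  shows "\<exists>b\<in>B. k < card {a \<in> A. f a = b}"
proof (rule ccontr)
  assume "\<not> ?thesis"
  then have "card {a \<in> A. f a = b} \<le> k" if "b \<in> B" for b using that by force
  then have "(\<Sum>b\<in>B. card {a \<in> A. f a = b}) \<le> card B * k"
    by (rule sum_bounded_above[where 'a = nat, simplified])
  moreover have "A = (\<Union>b\<in>B. {a \<in> A. f a = b})" using assms(3) by auto
  then have "card A \<le> (\<Sum>b\<in>B. card {a \<in> A. f a = b})"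
    using card_UN_le[OF assms(2), of "\<lambda>b. {a \<in> A. f a = b}"] by simp
  ultimately show False using assms(4) by (simp add: mult.commute)
qed

section \<open>Clearing the poles of a function where another function is regular\<close>

context function_field
begin

text \<open>If \<open>p l\<close> is the leading coefficient of an algebraic equation of
  \<open>f\<close> over \<open>K[x]\<close>, then \<open>p l * f\<close> is integral over
  \<open>K[x]\<close>, hence regular wherever \<open>x\<close> is.\<close>

lemma pole_clearing:
  assumes x: "x \<notin> K"
  obtains d where "d \<in> adjoin x" "d \<noteq> 0" "\<And>v. v \<in> closed_points K \<Longrightarrow> vge v 0 x \<Longrightarrow> vge v 0 (d * f)"
proof -
  obtain M where "dependent x (\<lambda>j. f ^ j) M" using dependent_large[of x] by blast
  then obtain n c where c: "\<And>j i. c j i \<in> K" "\<exists>j<M. \<exists>i\<le>n. c j i \<noteq> 0"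
    "(\<Sum>j<M. \<Sum>i\<le>n. c j i * x ^ i * f ^ j) = 0"
    unfolding dependent_def by blast
  define p where "p j = (\<Sum>i\<le>n. c j i * x ^ i)" for j
  have pA: "p j \<in> adjoin x" for j
    unfolding p_def using c(1) by (auto intro!: adjoin_sum adjoin_mult adjoin_power)
  define J where "J = {j. j < M \<and> p j \<noteq> 0}"
  \<comment> \<open>As \<open>x\<close> is transcendental, a nonzero coefficient makes the value of
    its polynomial nonzero.\<close>
  have "\<exists>j<M. p j \<noteq> 0"
    using c(2) transcendental[OF x, of "c _" n] c(1) unfolding p_def by blast
  then have J: "finite J" "J \<noteq> {}" by (auto simp: J_def)
  define l where "l = Max J"
  have l: "l < M" "p l \<noteq> 0" using Max_in[OF J] by (auto simp: l_def J_def)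
  have above: "p j = 0" if "l < j" "j < M" for j
    using Max_ge[OF J(1), of j] that unfolding l_def[symmetric] by (auto simp: J_def)
  have "(\<Sum>j<M. p j * f ^ j) = 0" using c(3) by (simp add: p_def sum_distrib_right)
  moreover have "(\<Sum>j<M. p j * f ^ j) = (\<Sum>j\<le>l. p j * f ^ j)"
    using l(1) above by (intro sum.mono_neutral_right) (auto simp: not_le)
  moreover have "(\<Sum>j\<le>l. p j * f ^ j) = (\<Sum>j<l. p j * f ^ j) + p l * f ^ l"
    by (simp add: lessThan_Suc_atMost[symmetric])
  ultimately have rel: "p l * f ^ l = - (\<Sum>j<l. p j * f ^ j)"
    by (simp add: eq_neg_iff_add_eq_0 add.commute)
  have "vge v 0 (p l * f)" if v: "v \<in> closed_points K" "vge v 0 x" for v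
  proof (rule ccontr)
    define g where "g = p l * f"
    assume "\<not> vge v 0 (p l * f)"
    then have g: "g \<noteq> 0" "v g < 0" by (auto simp: vge_def g_def)
    obtain k where k: "l = Suc k"
      using rel l(2) by (cases l) auto
    \<comment> \<open>Multiplying the relation by \<open>p l ^ k\<close>, where
      \<open>l = k + 1\<close>, gives the integral equation of \<open>g\<close>. Its right-hand side
      has order at least \<open>k * v g\<close>, which exceeds \<open>l * v g\<close> at a pole of
      \<open>g\<close>.\<close>
    have "g ^ l = p l ^ k * (p l * f ^ l)"
      by (simp add: g_def k power_mult_distrib mult_ac)
    also have "\<dots> = - (\<Sum>j<l. p l ^ (k - j) * p j * g ^ j)"
    proof -
      have eq: "p l ^ k * (p j * f ^ j) = p l ^ (k - j) * p j * g ^ j" if "j < l" for j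
      proof -
        have "p l ^ k = p l ^ (k - j) * p l ^ j"
          using that k by (simp flip: power_add)
        then show ?thesis by (simp add: g_def power_mult_distrib mult_ac)
      qed
      have "(\<Sum>j<l. p l ^ k * (p j * f ^ j)) = (\<Sum>j<l. p l ^ (k - j) * p j * g ^ j)"
        by (rule sum.cong[OF refl], rule eq) simp
      then show ?thesis unfolding rel by (simp only: mult_minus_right sum_distrib_left)
    qed
    finally have gl: "g ^ l = - (\<Sum>j<l. p l ^ (k - j) * p j * g ^ j)" .
    have "vge v (0 + int k * v g) (p l ^ (k - j) * p j * g ^ j)" if "j < l" for j
    proof (rule vge_mult[OF v(1)])
      show "vge v 0 (p l ^ (k - j) * p j)"
        using vge_adjoin[OF v(1) pA v(2)] by (intro vge_mult_nonneg[OF v(1)] vge_power_nonneg[OF v(1)])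
      have "int k * v g \<le> int j * v g" using that k g(2) by (intro mult_right_mono_neg) auto
      then show "vge v (int k * v g) (g ^ j)" using g by (simp add: vge_def val_power[OF v(1)])
    qed
    then have "vge v (int k * v g) (g ^ l)"
      unfolding gl by (intro vge_uminus[OF v(1)] vge_sum[OF v(1)]) auto
    then have "int k * v g \<le> int l * v g"
      using g(1) val_power[OF v(1) g(1), of l] by (simp add: vge_def)
    then show False using g(2) by (simp add: k algebra_simps)
  qed
  then show ?thesis using that[OF pA l(2)] by blast
qed

text \<open>The product of the individual denominators works, because each is a polynomial in
  \<open>x\<close> and so is itself regular where \<open>x\<close> is.\<close>

lemma pole_clearing_family:
  fixes N :: nat
  assumes x: "x \<notin> K"
  obtains d where "d \<noteq> 0" "\<And>v j. v \<in> closed_points K \<Longrightarrow> vge v 0 x \<Longrightarrow> j < N \<Longrightarrow> vge v 0 (d * u j)"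
proof -
  have "\<exists>d\<in>adjoin x. d \<noteq> 0 \<and> (\<forall>v\<in>closed_points K. vge v 0 x \<longrightarrow> vge v 0 (d * u j))" for j
    using pole_clearing[OF x, of "u j"] by metis
  then obtain d where d: "\<And>j. d j \<in> adjoin x" "\<And>j. d j \<noteq> 0"
    "\<And>j v. v \<in> closed_points K \<Longrightarrow> vge v 0 x \<Longrightarrow> vge v 0 (d j * u j)" by metis
  show ?thesis
  proof (rule that[of "\<Prod>j<N. d j"])
    show "(\<Prod>j<N. d j) \<noteq> 0" using d(2) by simp
    fix v j assume v: "v \<in> closed_points K" "vge v 0 x" and j: "j < N"
    have eq: "(\<Prod>j<N. d j) * u j = (\<Prod>i\<in>{..<N} - {j}. d i) * (d j * u j)"
      using j prod.remove[of "{..<N}" j d] by (simp add: mult_ac)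
    show "vge v 0 ((\<Prod>j<N. d j) * u j)"
      unfolding eq
      by (intro vge_mult_nonneg[OF v(1)] vge_prod_nonneg[OF v(1)] vge_adjoin[OF v(1) d(1) v(2)] d(3)[OF v])
  qed
qed

text \<open>With \<open>O\<close> the functions regular at \<open>S\<close>, the assumptions on \<open>g\<close> say that it is linearly
  independent in \<open>O / y O\<close>. Making the \<open>g j\<close> regular at \<open>Q\<close> modulo \<open>y O\<close> and adding a function that is
  a unit at \<open>Q\<close> but vanishes on \<open>S\<close> gives one more element that is independent over \<open>K[y]\<close>.\<close>

lemma independent_mod_extend:
  assumes Q: "Q \<in> closed_points K" "Q y = 1"
    and S: "finite S" "S \<subseteq> closed_points K" "Q \<notin> S" "\<And>v. v \<in> S \<Longrightarrow> 0 < v y"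
    and g: "\<And>j v. j < m \<Longrightarrow> v \<in> S \<Longrightarrow> vge v 0 (g j)"
    and ind: "\<And>c j. (\<And>j. c j \<in> K) \<Longrightarrow> (\<And>v. v \<in> S \<Longrightarrow> vge v (v y) (\<Sum>j<m. c j * g j)) \<Longrightarrow>
                j < m \<Longrightarrow> c j = 0"
  shows "\<exists>g'. \<not> dependent y g' (Suc m)"
proof -
  have y0: "y \<noteq> 0" using Q val_const[OF Q(1) zero_in_K] by auto
  \<comment> \<open>Large enough that \<open>1 - t\<close> absorbs the poles of all
    \<open>g j\<close> at \<open>Q\<close> and that \<open>t\<close> is divisible by
    \<open>y\<close> on \<open>S\<close>.\<close>
  define k where "k = nat ((\<Sum>j<m. \<bar>Q (g j)\<bar>) + (\<Sum>v\<in>S. \<bar>v y\<bar>))"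
  have k: "int k = (\<Sum>j<m. \<bar>Q (g j)\<bar>) + (\<Sum>v\<in>S. \<bar>v y\<bar>)"
    unfolding k_def by (intro nat_0_le add_nonneg_nonneg sum_nonneg) auto
  have k1: "- Q (g j) \<le> int k" if "j < m" for j
  proof -
    have "\<bar>Q (g j)\<bar> \<le> (\<Sum>j<m. \<bar>Q (g j)\<bar>)" using that by (intro member_le_sum) auto
    moreover have "0 \<le> (\<Sum>v\<in>S. \<bar>v y\<bar>)" by (intro sum_nonneg) auto
    ultimately show ?thesis unfolding k by linarith
  qed
  have k2: "v y \<le> int k" if "v \<in> S" for v
  proof -
    have "\<bar>v y\<bar> \<le> (\<Sum>v\<in>S. \<bar>v y\<bar>)" using that S(1) by (intro member_le_sum) auto
    moreover have "0 \<le> (\<Sum>j<m. \<bar>Q (g j)\<bar>)" by (intro sum_nonneg) auto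
    ultimately show ?thesis unfolding k by linarith
  qed
  obtain t where t: "t \<noteq> 0" "Q t = 0" "vge Q (int k) (1 - t)" "\<And>v. v \<in> S \<Longrightarrow> int k \<le> v t"
    using weak_approximation[OF Q(1) S(1-3)] by blast
  have cp: "v \<in> closed_points K" if "v \<in> S" for v using S(2) that by auto
  have tS: "vge v (v y) t" if "v \<in> S" for v
    using t(4)[OF that] k2[OF that] by (auto simp: vge_def)
  have tS0: "vge v 0 t" if "v \<in> S" for v
    using tS[OF that] S(4)[OF that] by (auto simp: vge_def)
  define g' where "g' j = (if j < m then g j * (1 - t) else t)" for j
  have g'S: "vge v 0 (g' j)" if v: "v \<in> S" for v j
  proof -
    have "vge v 0 (1 - t)" by (rule vge_diff[OF cp[OF v] vge_const[OF cp[OF v] one_in_K] tS0[OF v]])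
    then show ?thesis
      unfolding g'_def using g[OF _ v] tS0[OF v] vge_mult_nonneg[OF cp[OF v]] by simp
  qed
  have g'Q: "vge Q 0 (g' j)" for j
  proof (cases "j < m")
    case True
    have "vge Q (Q (g j)) (g j)" by (simp add: vge_def)
    from vge_mult[OF Q(1) this t(3)] have "vge Q 0 (g j * (1 - t))"
      by (rule vge_mono) (use k1[OF True] in linarith)
    then show ?thesis using True by (simp add: g'_def)
  qed (use t in \<open>simp add: g'_def vge_def\<close>)
  have "\<not> dependent y g' (Suc m)"
  proof
    assume "dependent y g' (Suc m)"
    then obtain c r where cr: "\<And>j. c j \<in> K" "\<And>j. r j \<in> adjoin y" "\<exists>j<Suc m. c j \<noteq> 0"
      "(\<Sum>j<Suc m. c j * g' j) = y * (\<Sum>j<Suc m. r j * g' j)"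
      using dependent_modulo[OF _ y0] by blast
    have rhs: "vge v (v y) (\<Sum>j<Suc m. c j * g' j)"
      if v: "v \<in> closed_points K" "0 < v y" "\<And>j. vge v 0 (g' j)" for v
    proof -
      have "vge v 0 (\<Sum>j<Suc m. r j * g' j)"
        using v by (intro vge_sum[OF v(1)] vge_mult_nonneg[OF v(1)] vge_adjoin[OF v(1) cr(2)] v(3))
          (auto simp: vge_def)
      then have "vge v (v y + 0) (y * (\<Sum>j<Suc m. r j * g' j))"
        by (intro vge_mult[OF v(1)]) (auto simp: vge_def)
      then show ?thesis unfolding cr(4) by simp
    qed
    have sum_eq: "(\<Sum>j<Suc m. c j * g' j) = (\<Sum>j<m. c j * g j) - (\<Sum>j<m. c j * (g j * t)) + c m * t"
      by (simp add: g'_def right_diff_distrib sum_subtractf)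
    \<comment> \<open>On \<open>S\<close> all terms containing \<open>t\<close> vanish modulo
      \<open>y\<close>, so the relation reduces to one among the \<open>g j\<close>, and
      \<open>ind\<close> makes it trivial.\<close>
    have "vge v (v y) (\<Sum>j<m. c j * g j)" if v: "v \<in> S" for v
    proof -
      have gt: "vge v (v y) (g j * t)" if "j < m" for j
        using vge_mult[OF cp[OF v] g[OF that v] tS[OF v]] by simp
      have "(\<Sum>j<m. c j * g j) = (\<Sum>j<Suc m. c j * g' j) + (\<Sum>j<m. c j * (g j * t)) - c m * t"
        unfolding sum_eq by simp
      moreover have "vge v (v y) (\<Sum>j<m. c j * (g j * t))"
        using gt by (intro vge_sum[OF cp[OF v]] vge_const_mult[OF cp[OF v] cr(1)]) simp
      from vge_diff[OF cp[OF v] vge_add[OF cp[OF v] rhs[OF cp[OF v] S(4)[OF v] g'S[OF v]] this]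
          vge_const_mult[OF cp[OF v] cr(1) tS[OF v]]]
      have "vge v (v y) ((\<Sum>j<Suc m. c j * g' j) + (\<Sum>j<m. c j * (g j * t)) - c m * t)" .
      ultimately show ?thesis by simp
    qed
    then have c0: "c j = 0" if "j < m" for j using ind[of c j] cr(1) that by blast
    then have cm: "c m \<noteq> 0" using cr(3) by (auto simp: less_Suc_eq)
    \<comment> \<open>The relation is left with \<open>c m * t\<close>, which \<open>y\<close> would
      have to divide at \<open>Q\<close>, although \<open>t\<close> is a unit there.\<close>
    have "(\<Sum>j<Suc m. c j * g' j) = c m * t" unfolding sum_eq using c0 by simp
    then have "vge Q 1 (c m * t)" using rhs[OF Q(1) _ g'Q] Q(2) by simp
    then show False
      using cm t(1,2) val_mult[OF Q(1), of "c m" t] val_const[OF Q(1) cr(1), of m] by (simp add: vge_def)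
  qed
  then show ?thesis by blast
qed

text \<open>A family of maximal length among those independent in \<open>O / y O\<close> generates
  this quotient over \<open>K\<close>. Its length is strictly below \<open>N\<close> because
  \<open>independent_mod_extend\<close> produces a family longer by one that is independent over
  \<open>K[y]\<close>.\<close>

lemma quotient_generators:
  assumes Q: "Q \<in> closed_points K" "Q y = 1"
    and S: "finite S" "S \<subseteq> closed_points K" "Q \<notin> S" "\<And>v. v \<in> S \<Longrightarrow> 0 < v y"
    and N: "\<And>n g. N < n \<Longrightarrow> dependent y g n"
  shows "\<exists>m g. m < N \<and> (\<forall>f. (\<forall>v\<in>S. vge v 0 f) \<longrightarrow>
           (\<exists>c. (\<forall>j. c j \<in> K) \<and> (\<forall>v\<in>S. vge v (v y) (f - (\<Sum>j<m. c j * g j)))))"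
proof -
  define P where "P g m \<longleftrightarrow> (\<forall>j<m. \<forall>v\<in>S. vge v 0 (g j)) \<and>
    (\<forall>c. (\<forall>j. c j \<in> K) \<longrightarrow> (\<forall>v\<in>S. vge v (v y) (\<Sum>j<m. c j * g j)) \<longrightarrow> (\<forall>j<m. c j = 0))" for g and m :: nat
  have bound: "m < N" if P: "P g m" for g m
  proof (rule ccontr)
    assume "\<not> m < N"
    then have "dependent y g' (Suc m)" for g' using N by auto
    moreover have "\<exists>g'. \<not> dependent y g' (Suc m)"
      by (rule independent_mod_extend[OF Q S(1,2,3), of m g]) (use S(4) P in \<open>auto simp: P_def\<close>)
    ultimately show False by blast
  qed
  define m where "m = (GREATEST m. \<exists>g. P g m)"
  have ex: "\<exists>g. P g 0" by (auto simp: P_def)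
  have bd: "\<And>m. \<exists>g. P g m \<Longrightarrow> m \<le> N" using bound by force
  obtain g where g: "P g m"
    using GreatestI_nat[of "\<lambda>m. \<exists>g. P g m" 0 N, OF ex bd] unfolding m_def by blast
  have max: "\<not> P g' (Suc m)" for g'
    using Greatest_le_nat[of "\<lambda>m. \<exists>g. P g m" "Suc m" N] bd unfolding m_def[symmetric] by fastforce
  \<comment> \<open>Appending \<open>f\<close> to the maximal family creates a relation. It must
    involve \<open>f\<close>, and dividing by the coefficient of \<open>f\<close> solves for
    \<open>f\<close> modulo \<open>y\<close>.\<close>
  have "\<exists>c. (\<forall>j. c j \<in> K) \<and> (\<forall>v\<in>S. vge v (v y) (f - (\<Sum>j<m. c j * g j)))"
    if f: "\<And>v. v \<in> S \<Longrightarrow> vge v 0 f" for f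
  proof -
    have "\<forall>j<Suc m. \<forall>v\<in>S. vge v 0 ((g(m := f)) j)"
      using g f by (auto simp: P_def less_Suc_eq)
    then obtain c where c: "\<And>j. c j \<in> K" "\<And>v. v \<in> S \<Longrightarrow> vge v (v y) (\<Sum>j<Suc m. c j * (g(m := f)) j)"
      "\<exists>j<Suc m. c j \<noteq> 0"
      using max[of "g(m := f)"] unfolding P_def by blast
    have eq: "(\<Sum>j<Suc m. c j * (g(m := f)) j) = (\<Sum>j<m. c j * g j) + c m * f" by simp
    have "c m \<noteq> 0"
    proof
      assume 0: "c m = 0"
      then have "\<forall>v\<in>S. vge v (v y) (\<Sum>j<m. c j * g j)" using c(2) eq by auto
      then have "\<forall>j<m. c j = 0" using g c(1) unfolding P_def by blast
      then show False using c(3) 0 by (auto simp: less_Suc_eq)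
    qed
    then have eq': "f - (\<Sum>j<m. (- (inverse (c m) * c j)) * g j) = inverse (c m) * ((\<Sum>j<m. c j * g j) + c m * f)"
      by (simp add: sum_distrib_left algebra_simps sum_negf)
    have "vge v (v y) (f - (\<Sum>j<m. (- (inverse (c m) * c j)) * g j))" if "v \<in> S" for v
      unfolding eq' using c(2)[OF that] S(2) that c(1) unfolding eq by (auto intro!: vge_const_mult)
    moreover have "- (inverse (c m) * c j) \<in> K" for j
      by (intro uminus_in_K mult_in_K inverse_in_K c(1))
    ultimately show ?thesis
      by (intro exI[of _ "\<lambda>j. - (inverse (c m) * c j)"] conjI allI ballI)
  qed
  then show ?thesis using bound[OF g] by blast
qed

text \<open>Expansion on \<open>S\<close> in powers of \<open>1 / y\<close>, with generators of
  \<open>O / y O\<close> as digits: the leading digit is stripped off and the denominator drops by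
  one factor \<open>y\<close>. Index \<open>k\<close> belongs to the power
  \<open>inverse y ^ (k + 1)\<close>, since regular terms are not recorded.\<close>

lemma principal_part:
  assumes y: "y \<noteq> 0" and S: "S \<subseteq> closed_points K"
    and gen: "\<And>f. \<forall>v\<in>S. vge v 0 f \<Longrightarrow>
        \<exists>c. (\<forall>j. c j \<in> K) \<and> (\<forall>v\<in>S. vge v (v y) (f - (\<Sum>j<m. c j * g j)))"
    and f: "\<And>v. v \<in> S \<Longrightarrow> vge v 0 (y ^ n * f)"
  shows "\<exists>c. (\<forall>k j. c k j \<in> K) \<and>
    (\<forall>v\<in>S. vge v 0 (f - (\<Sum>k<n. \<Sum>j<m. c k j * (inverse y ^ Suc k * g j))))"
  using f
proof (induction n arbitrary: f)
  case 0
  then show ?case by (intro exI[of _ "\<lambda>_ _. 0"]) auto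
next
  case (Suc n)
  obtain c where c: "\<And>j. c j \<in> K" "\<And>v. v \<in> S \<Longrightarrow> vge v (v y) (y ^ Suc n * f - (\<Sum>j<m. c j * g j))"
    using gen[of "y ^ Suc n * f"] Suc.prems by blast
  define f' where "f' = f - (\<Sum>j<m. c j * (inverse y ^ Suc n * g j))"
  have one: "y * (y ^ n * (inverse y * inverse y ^ n)) = 1"
    using y by (simp add: power_inverse field_simps)
  have "y ^ Suc n * (\<Sum>j<m. c j * (inverse y ^ Suc n * g j))
      = (y * (y ^ n * (inverse y * inverse y ^ n))) * (\<Sum>j<m. c j * g j)"
    by (simp add: sum_distrib_left mult_ac)
  then have "y * (y ^ n * f') = y ^ Suc n * f - (\<Sum>j<m. c j * g j)"
    unfolding one by (simp add: f'_def right_diff_distrib mult.assoc)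
  then have "y ^ n * f' = inverse y * (y ^ Suc n * f - (\<Sum>j<m. c j * g j))"
    using y by (simp add: field_simps)
  moreover have "vge v (- v y + v y) (inverse y * (y ^ Suc n * f - (\<Sum>j<m. c j * g j)))" if "v \<in> S" for v
    using S that c(2)[OF that] by (intro vge_mult) (auto simp: vge_def val_inverse)
  ultimately have "\<And>v. v \<in> S \<Longrightarrow> vge v 0 (y ^ n * f')" by simp
  from Suc.IH[OF this] obtain d where d: "\<And>k j. d k j \<in> K"
    "\<And>v. v \<in> S \<Longrightarrow> vge v 0 (f' - (\<Sum>k<n. \<Sum>j<m. d k j * (inverse y ^ Suc k * g j)))" by blast
  have "f - (\<Sum>k<Suc n. \<Sum>j<m. (d(n := c)) k j * (inverse y ^ Suc k * g j))
      = f' - (\<Sum>k<n. \<Sum>j<m. d k j * (inverse y ^ Suc k * g j))"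
    by (simp add: f'_def)
  then show ?case using c(1) d
    by (intro exI[of _ "d(n := c)"]) (auto simp del: sum.lessThan_Suc power_Suc)
qed

text \<open>A counting substitute for Riemann's inequality: each power of \<open>1 / y\<close>
  offers \<open>N\<close> free constants, while a principal part on \<open>S\<close> costs only
  \<open>m < N\<close> constants per power. For high powers some principal part is therefore shared
  by more than \<open>card K\<close> combinations.\<close>

lemma function_with_single_pole:
  assumes Q: "Q \<in> closed_points K"
  obtains h where "Q h < 0" "\<And>v. v \<in> closed_points K \<Longrightarrow> v \<noteq> Q \<Longrightarrow> vge v 0 h"
proof -
  obtain y where y: "y \<noteq> 0" "Q y = 1" using val_uniformizer[OF Q] by blast
  define x where "x = inverse y"
  have "Q x \<noteq> 0" using y by (simp add: x_def val_inverse[OF Q])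
  then have xK: "x \<notin> K" by (rule val_nonzero_not_const[OF Q])
  obtain M where M: "\<And>m g. M \<le> m \<Longrightarrow> dependent y g m" using dependent_large[of y] by blast
  define N where "N = (GREATEST m. \<exists>g. \<not> dependent y g m)"
  have ex: "\<exists>g. \<not> dependent y g 0" by (auto simp: dependent_def)
  have bd: "\<And>m. \<exists>g. \<not> dependent y g m \<Longrightarrow> m \<le> M" using M by (meson nat_le_linear)
  obtain u0 where u0: "\<not> dependent y u0 N"
    using GreatestI_nat[of "\<lambda>m. \<exists>g. \<not> dependent y g m" 0 M, OF ex bd] unfolding N_def by blast
  have N: "dependent y g n" if "N < n" for n g
    using Greatest_le_nat[of "\<lambda>m. \<exists>g. \<not> dependent y g m" n M] bd that unfolding N_def[symmetric] by fastforce
  \<comment> \<open>Rescaled by \<open>d\<close>, the functions become regular where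
    \<open>1 / y\<close> is, so that their poles lie in \<open>S\<close> or at
    \<open>Q\<close>.\<close>
  obtain d where d: "d \<noteq> 0" "\<And>v j. v \<in> closed_points K \<Longrightarrow> vge v 0 x \<Longrightarrow> j < N \<Longrightarrow> vge v 0 (d * u0 j)"
    using pole_clearing_family[OF xK] by blast
  define u where "u j = d * u0 j" for j
  have u: "\<not> dependent y u N" using u0 dependent_scale[OF d(1), of y u0 N] unfolding u_def by blast
  define S where "S = {v \<in> closed_points K. 0 < v y} - {Q}"
  have S: "finite S" "S \<subseteq> closed_points K" "Q \<notin> S" "\<And>v. v \<in> S \<Longrightarrow> 0 < v y"
    using finite_zeros[of y] by (auto simp: S_def)
  have cp: "v \<in> closed_points K" if "v \<in> S" for v using S(2) that by auto
  have "\<exists>m g. m < N \<and> (\<forall>f. (\<forall>v\<in>S. vge v 0 f) \<longrightarrow>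
      (\<exists>c. (\<forall>j. c j \<in> K) \<and> (\<forall>v\<in>S. vge v (v y) (f - (\<Sum>j<m. c j * g j)))))"
    by (rule quotient_generators[OF Q y(2) S(1-3)]) (use S(4) N in auto)
  then obtain m g where g: "m < N" "\<And>f. \<forall>v\<in>S. vge v 0 f \<Longrightarrow>
      \<exists>c. (\<forall>j. c j \<in> K) \<and> (\<forall>v\<in>S. vge v (v y) (f - (\<Sum>j<m. c j * g j)))"
    by blast
  \<comment> \<open>\<open>e\<close> bounds the pole orders of all \<open>u j\<close> on
    \<open>S\<close>.\<close>
  define e where "e = (\<Sum>j<N. \<Sum>v\<in>S. nat \<bar>v (u j)\<bar>)"
  have e: "vge v 0 (y ^ e * u j)" if "v \<in> S" "j < N" for v j
  proof (cases "u j = 0")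
    case False
    have "nat \<bar>v (u j)\<bar> \<le> (\<Sum>v\<in>S. nat \<bar>v (u j)\<bar>)" using that S(1) by (intro member_le_sum) auto
    also have "\<dots> \<le> e" unfolding e_def using that by (intro member_le_sum) auto
    finally have "\<bar>v (u j)\<bar> \<le> int e" by linarith
    moreover have "int e * 1 \<le> int e * v y" using S(4)[OF that(1)] by (intro mult_left_mono) auto
    moreover have "v (y ^ e * u j) = int e * v y + v (u j)"
      using val_mult[OF cp[OF that(1)], of "y ^ e" "u j"] val_power[OF cp[OF that(1)], of y e] y(1) False
      by simp
    ultimately show ?thesis unfolding vge_def by linarith
  qed simp
  \<comment> \<open>As \<open>m \<le> N - 1\<close>, this \<open>n\<close> makes
    \<open>N * (n + 1) - (n + e) * m\<close> at least \<open>N + e + 1 \<ge> 2\<close>, enough for a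
    fiber with more than \<open>card K\<close> elements.\<close>
  define n where "n = e * N + 1"
  define \<phi> where "\<phi> a = (\<Sum>j<N. \<Sum>i\<le>n. a (j, i) * x ^ i * u j)" for a
  define A where "A = ({..<N} \<times> {..n}) \<rightarrow>\<^sub>E K"
  have A: "a (j, i) \<in> K" if "a \<in> A" "j < N" "i \<le> n" for a j i
    using that by (auto simp: A_def PiE_iff)
  have \<phi>S: "vge v 0 (y ^ (n + e) * \<phi> a)" if a: "a \<in> A" and v: "v \<in> S" for a v
  proof -
    have eq: "y ^ (n + e) * (a (j, i) * x ^ i * u j) = a (j, i) * (y ^ (n - i) * (y ^ e * u j))"
      if "i \<le> n" for i j
      using y(1) that by (simp add: x_def power_add power_diff power_inverse field_simps)
    have "y ^ (n + e) * \<phi> a = (\<Sum>j<N. \<Sum>i\<le>n. a (j, i) * (y ^ (n - i) * (y ^ e * u j)))"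
      unfolding \<phi>_def sum_distrib_left by (intro sum.cong refl, rule eq) simp
    moreover have y0: "vge v 0 y" using S(4)[OF v] by (simp add: vge_def)
    have "vge v 0 (a (j, i) * (y ^ (n - i) * (y ^ e * u j)))" if "j < N" "i \<le> n" for j i
      by (rule vge_const_mult[OF cp[OF v] A[OF a that]
            vge_mult_nonneg[OF cp[OF v] vge_power_nonneg[OF cp[OF v] y0] e[OF v that(1)]]])
    then have "vge v 0 (\<Sum>j<N. \<Sum>i\<le>n. a (j, i) * (y ^ (n - i) * (y ^ e * u j)))"
      by (intro vge_sum[OF cp[OF v]]) auto
    ultimately show ?thesis by simp
  qed
  have \<phi>_other: "vge v 0 (\<phi> a)" if a: "a \<in> A" and v: "v \<in> closed_points K" "v \<noteq> Q" "v \<notin> S" for a v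
  proof -
    have "v y \<le> 0" using v by (auto simp: S_def)
    then have x0: "vge v 0 x" by (simp add: vge_def x_def val_inverse[OF v(1)])
    have "vge v 0 (a (j, i) * (x ^ i * u j))" if "j < N" "i \<le> n" for j i
      unfolding u_def
      by (rule vge_const_mult[OF v(1) A[OF a that]
            vge_mult_nonneg[OF v(1) vge_power_nonneg[OF v(1) x0] d(2)[OF v(1) x0 that(1)]]])
    then show ?thesis unfolding \<phi>_def mult.assoc by (intro vge_sum[OF v(1)]) auto
  qed
  \<comment> \<open>A collision is a relation in powers of \<open>1 / y\<close>;
    \<open>dependent_inverse\<close> turns it into one over \<open>K[y]\<close>.\<close>
  have inj: "inj_on \<phi> A"
  proof (rule inj_onI, rule ccontr)
    fix a b assume ab: "a \<in> A" "b \<in> A" "\<phi> a = \<phi> b" "a \<noteq> b"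
    then obtain j i where ji: "j < N" "i \<le> n" "a (j, i) \<noteq> b (j, i)"
      unfolding A_def using PiE_ext[of a _ _ b] by (metis SigmaE lessThan_iff atMost_iff)
    define c where "c j i = (if j < N \<and> i \<le> n then a (j, i) - b (j, i) else 0)" for j i
    have "(\<Sum>j<N. \<Sum>i\<le>n. c j i * inverse y ^ i * u j) = \<phi> a - \<phi> b"
      by (simp add: \<phi>_def c_def x_def left_diff_distrib sum_subtractf)
    then have "(\<Sum>j<N. \<Sum>i\<le>n. c j i * inverse y ^ i * u j) = 0" using ab(3) by simp
    moreover have "c j i \<in> K" for j i using A ab(1,2) by (auto simp: c_def)
    moreover have "c j i \<noteq> 0" using ji by (simp add: c_def)
    ultimately show False using dependent_inverse[OF y(1), of c j N i n u] ji u by blast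
  qed
  define good where "good a c \<longleftrightarrow> (\<forall>k j. c k j \<in> K) \<and>
    (\<forall>v\<in>S. vge v 0 (\<phi> a - (\<Sum>k<n + e. \<Sum>j<m. c k j * (inverse y ^ Suc k * g j))))" for a c
  have "\<exists>c. good a c" if "a \<in> A" for a
    unfolding good_def by (rule principal_part[OF y(1) S(2) g(2) \<phi>S[OF that]])
  then obtain pp where good: "\<And>a. a \<in> A \<Longrightarrow> good a (pp a)" by metis
  have pp: "pp a k j \<in> K" "v \<in> S \<Longrightarrow>
      vge v 0 (\<phi> a - (\<Sum>k<n + e. \<Sum>j<m. pp a k j * (inverse y ^ Suc k * g j)))" if "a \<in> A" for a k j v
    using good[OF that] unfolding good_def by blast+
  \<comment> \<open>The principal part on \<open>S\<close>, recorded by its digits; functions with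
    the same value differ by a function regular on \<open>S\<close>.\<close>
  define \<psi> where "\<psi> a = restrict (\<lambda>(k, j). pp a k j) ({..<n + e} \<times> {..<m})" for a
  define B where "B = ({..<n + e} \<times> {..<m}) \<rightarrow>\<^sub>E K"
  have finA: "finite A" and finB: "finite B" unfolding A_def B_def by (auto intro!: finite_PiE)
  have cardA: "card A = card K ^ (N * Suc n)" and cardB: "card B = card K ^ ((n + e) * m)"
    by (simp_all add: A_def B_def card_PiE card_cartesian_product)
  have "card K * card B < card A"
  proof -
    obtain l where l: "N = Suc l" "m \<le> l" using g(1) by (cases N) auto
    have "(n + e) * m \<le> (n + e) * l" using l(2) by simp
    then have "Suc ((n + e) * m) < N * Suc n"
      using l(1) by (simp add: n_def algebra_simps)
    then have "card K ^ Suc ((n + e) * m) < card K ^ (N * Suc n)"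
      using card_K_ge_2 by (intro power_strict_increasing) auto
    then show ?thesis by (simp add: cardA cardB)
  qed
  moreover have "\<psi> ` A \<subseteq> B"
    unfolding \<psi>_def B_def using pp(1) by (auto intro!: restrict_PiE_iff[THEN iffD2])
  ultimately obtain b where b: "b \<in> B" "card K < card {a \<in> A. \<psi> a = b}"
    using pigeonhole_fiber[OF finA finB] by blast
  define Fb where "Fb = {a \<in> A. \<psi> a = b}"
  have "Fb \<noteq> {}" using b(2) unfolding Fb_def[symmetric] by (metis card.empty not_less0)
  then obtain a0 where a0: "a0 \<in> Fb" by blast
  have "inj_on (\<lambda>a. \<phi> a - \<phi> a0) Fb"
    using inj by (auto simp: inj_on_def Fb_def)
  then have "card ((\<lambda>a. \<phi> a - \<phi> a0) ` Fb) > card K"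
    using b(2) by (simp add: card_image Fb_def)
  \<comment> \<open>The differences outnumber the constants, so one of them is nonconstant.\<close>
  then have "\<not> (\<lambda>a. \<phi> a - \<phi> a0) ` Fb \<subseteq> K"
    using card_mono[OF finite_K] by (metis linorder_not_less)
  then obtain a where a: "a \<in> Fb" "\<phi> a - \<phi> a0 \<notin> K" by blast
  define h where "h = \<phi> a - \<phi> a0"
  have aA: "a \<in> A" "a0 \<in> A" and eq: "\<psi> a = \<psi> a0" using a a0 by (auto simp: Fb_def)
  have ppeq: "pp a k j = pp a0 k j" if "k < n + e" "j < m" for k j
    using fun_cong[OF eq, of "(k, j)"] that by (simp add: \<psi>_def)
  have reg: "vge v 0 h" if v: "v \<in> closed_points K" "v \<noteq> Q" for v
  proof (cases "v \<in> S")
    case True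
    have "h = (\<phi> a - (\<Sum>k<n + e. \<Sum>j<m. pp a k j * (inverse y ^ Suc k * g j)))
        - (\<phi> a0 - (\<Sum>k<n + e. \<Sum>j<m. pp a0 k j * (inverse y ^ Suc k * g j)))"
      using ppeq by (simp add: h_def)
    then show ?thesis using vge_diff[OF v(1) pp(2)[OF aA(1) True] pp(2)[OF aA(2) True]] by simp
  next
    case False
    then show ?thesis unfolding h_def using \<phi>_other[OF _ v False] aA by (intro vge_diff[OF v(1)])
  qed
  obtain v where v: "v \<in> closed_points K" "v h < 0" using pole_exists a(2) unfolding h_def by blast
  have "h \<noteq> 0" using a(2) zero_in_K unfolding h_def by metis
  then have "v = Q" using reg[of v] v by (auto simp: vge_def)
  then show ?thesis using that[of h] v reg by blast
qed

end

section \<open>Functions of prescribed order\<close>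

context function_field
begin

text \<open>Let \<open>h\<close> vanish at \<open>P\<close> with its only pole at \<open>Q\<close>,
  and let \<open>u\<close> have a pole at \<open>P\<close> and a zero at \<open>v\<close>. In a
  relation among the powers of \<open>u\<close> over \<open>K[h]\<close>, some coefficient
  \<open>p l\<close> is a unit at \<open>P\<close>. The tail of the relation beyond index
  \<open>l\<close>, divided by \<open>u ^ l\<close>, is the desired \<open>t\<close>: it is regular
  away from \<open>Q\<close>, congruent to \<open>- p l\<close> at \<open>P\<close>, and divisible
  by \<open>u\<close> at \<open>v\<close>.\<close>

lemma separating_function:
  assumes P: "P \<in> rational_points K" and Q: "Q \<in> closed_points K" and PQ: "P \<noteq> Q"
    and v: "v \<in> closed_points K" "v \<noteq> P" "v \<noteq> Q"
  shows "\<exists>t. t \<noteq> 0 \<and> P t = 0 \<and> 0 < v t \<and> (\<forall>w\<in>closed_points K. w \<noteq> Q \<longrightarrow> vge w 0 t)"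
proof -
  have P': "P \<in> closed_points K" using P by (simp add: rational_points_def)
  obtain h0 where h0: "Q h0 < 0" "\<And>w. w \<in> closed_points K \<Longrightarrow> w \<noteq> Q \<Longrightarrow> vge w 0 h0"
    using function_with_single_pole[OF Q] by blast
  have h0K: "h0 \<notin> K" using h0(1) val_nonzero_not_const[OF Q, of h0] by simp
  \<comment> \<open>Rationality of \<open>P\<close> supplies a constant value of \<open>h0\<close>
    at \<open>P\<close>; subtracting it makes \<open>h\<close> vanish there.\<close>
  obtain a where a: "a \<in> K" "h0 - a \<in> local_max_ideal P"
    using P h0(2)[OF P' PQ] by (auto simp: rational_points_def local_ring_def vge_def)
  define h where "h = h0 - a"
  have h_nz: "h \<noteq> 0" using h0K a(1) by (auto simp: h_def)
  have hP: "vge P 1 h" using a(2) by (auto simp: local_max_ideal_def h_def vge_def)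
  have hreg: "vge w 0 h" if "w \<in> closed_points K" "w \<noteq> Q" for w
    unfolding h_def using h0(2)[OF that] vge_const[OF that(1) a(1)] by (rule vge_diff[OF that(1)])
  obtain u where u: "u \<noteq> 0" "P u < 0" "0 < v u"
    using weak_separation[OF P' v(1)] v(2) by metis
  obtain M where "dependent h (\<lambda>j. u ^ j) M" using dependent_large[of h] by blast
  then obtain c r where cr: "\<And>j. c j \<in> K" "\<And>j. r j \<in> adjoin h" "\<exists>j<M. c j \<noteq> 0"
    "(\<Sum>j<M. (c j + h * r j) * u ^ j) = 0"
    using dependent_normal[OF h_nz] by blast
  define p where "p j = c j + h * r j" for j
  have pA: "p j \<in> adjoin h" for j using cr(1,2) by (auto simp: p_def)
  have preg: "vge w 0 (p j)" if "w \<in> closed_points K" "w \<noteq> Q" for w j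
    by (rule vge_adjoin[OF that(1) pA hreg[OF that]])
  obtain l where l: "l < M" "c l \<noteq> 0" using cr(3) by blast
  have rP: "vge P 1 (h * r j)" for j
    using vge_mult[OF P' hP vge_adjoin[OF P' cr(2) hreg[OF P' PQ]]] by simp
  have pl: "p l \<noteq> 0" "P (p l) = 0"
    unfolding p_def using val_const_add[OF P' cr(1) l(2) rP] by auto
  \<comment> \<open>Seidenberg's trick: where \<open>u\<close> is regular, so is \<open>b i\<close>; where \<open>u\<close> has a pole, the relation rewrites
    \<open>b i\<close> and \<open>b i * u\<close> as polynomials in \<open>1 / u\<close>.\<close>
  define b where "b i = (\<Sum>j\<in>{i..<M}. p j * u ^ (j - i))" for i
  have b_step: "b i = p i + b (Suc i) * u" if "i < M" for i
  proof -
    have "b i = p i + (\<Sum>j\<in>{Suc i..<M}. p j * u ^ (j - i))"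
      using that by (simp add: b_def sum.atLeast_Suc_lessThan)
    also have "(\<Sum>j\<in>{Suc i..<M}. p j * u ^ (j - i)) = b (Suc i) * u"
      unfolding b_def sum_distrib_right by (intro sum.cong) (auto simp: Suc_diff_Suc simp flip: power_Suc2)
    finally show ?thesis .
  qed
  have rel: "(\<Sum>j\<in>{..<i}. p j * u ^ j) + u ^ i * b i = 0" if "i \<le> M" for i
  proof -
    have "(\<Sum>j<M. p j * u ^ j) = (\<Sum>j\<in>{..<i}. p j * u ^ j) + (\<Sum>j\<in>{i..<M}. p j * u ^ j)"
      using that sum.atLeastLessThan_concat[of 0 i M "\<lambda>j. p j * u ^ j"] by (simp add: atLeast0LessThan)
    moreover have "(\<Sum>j\<in>{i..<M}. p j * u ^ j) = u ^ i * b i"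
      unfolding b_def sum_distrib_left
    proof (intro sum.cong refl)
      fix j assume "j \<in> {i..<M}"
      then have "u ^ j = u ^ i * u ^ (j - i)" by (simp flip: power_add)
      then show "p j * u ^ j = u ^ i * (p j * u ^ (j - i))" by simp
    qed
    ultimately show ?thesis using cr(4) by (simp add: p_def)
  qed
  have breg: "vge w 0 (b i * u)" if w: "w \<in> closed_points K" "w \<noteq> Q" and i: "i \<le> M" for w i
  proof (cases "vge w 0 u")
    case True
    then show ?thesis unfolding b_def
      by (intro vge_mult_nonneg[OF w(1)] vge_sum[OF w(1)] vge_power_nonneg[OF w(1)] preg[OF w])
  next
    case False
    then have inv: "vge w 0 (inverse u)" by (simp add: vge_def val_inverse[OF w(1)])
    have one: "inverse u ^ j * u ^ j = 1" for j using u(1) by (simp add: power_inverse)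
    show ?thesis
    proof (cases i)
      case 0
      then have "b i = 0" using rel[of 0] by simp
      then show ?thesis by simp
    next
      case (Suc k)
      have "u ^ k * (b i * u) = u ^ i * b i" using Suc by (simp add: mult_ac)
      also have "\<dots> = - (\<Sum>j\<in>{..<i}. p j * u ^ j)" using rel[OF i] by (simp only: add_eq_0_iff)
      finally have "u ^ k * (b i * u) = - (\<Sum>j\<in>{..<i}. p j * u ^ j)" .
      then have "(inverse u ^ k * u ^ k) * (b i * u) = inverse u ^ k * (- (\<Sum>j\<in>{..<i}. p j * u ^ j))"
        by (simp only: mult.assoc)
      then have "b i * u = inverse u ^ k * (- (\<Sum>j\<in>{..<i}. p j * u ^ j))"
        by (simp only: one mult_1_left)
      also have "\<dots> = - (\<Sum>j\<in>{..<i}. p j * inverse u ^ (k - j))"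
        unfolding mult_minus_right sum_distrib_left
      proof (intro arg_cong[of _ _ uminus] sum.cong refl)
        fix j assume "j \<in> {..<i}"
        then have "inverse u ^ k = inverse u ^ (k - j) * inverse u ^ j"
          using Suc by (simp flip: power_add)
        then have "inverse u ^ k * (p j * u ^ j) = p j * inverse u ^ (k - j) * (inverse u ^ j * u ^ j)"
          by (simp only: mult_ac)
        then show "inverse u ^ k * (p j * u ^ j) = p j * inverse u ^ (k - j)"
          by (simp only: one mult_1_right)
      qed
      finally show ?thesis
        using inv by (simp only:)
          (intro vge_uminus[OF w(1)] vge_sum[OF w(1)] vge_mult_nonneg[OF w(1)] preg[OF w] vge_power_nonneg[OF w(1)])
    qed
  qed
  \<comment> \<open>The product \<open>b i * u\<close> is regular at \<open>P\<close>, where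
    \<open>u\<close> has a pole, so \<open>b i\<close> vanishes there.\<close>
  have bP: "vge P 1 (b i)" if "i \<le> M" for i
  proof (cases "b i = 0")
    case False
    then show ?thesis
      using breg[OF P' PQ that] u(1,2) val_mult[OF P' False u(1)] by (simp add: vge_def)
  qed simp
  have bv: "vge v 0 (b i)" if "i \<le> M" for i
    unfolding b_def using u(3)
    by (intro vge_sum[OF v(1)] vge_mult_nonneg[OF v(1)] preg[OF v(1,3)] vge_power_nonneg[OF v(1)])
      (simp add: vge_def)
  define t where "t = b (Suc l) * u"
  have t_eq: "t = - p l + b l" using b_step[OF l(1)] by (simp add: t_def)
  have t: "t \<noteq> 0" "P t = 0"
    unfolding t_eq using val_add_dominant[OF P', of "- p l" "b l"] pl bP[of l] l(1)
    by (simp_all add: val_uminus[OF P'])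
  have "vge v (0 + v u) t" unfolding t_def using l(1)
    by (intro vge_mult[OF v(1)] bv) (auto simp: vge_def)
  then have "0 < v t" using t(1) u(3) by (simp add: vge_def)
  moreover have "\<forall>w\<in>closed_points K. w \<noteq> Q \<longrightarrow> vge w 0 t"
    unfolding t_def using breg l(1) by auto
  ultimately show ?thesis using t by blast
qed

text \<open>A power of a uniformizer has the right order at \<open>P\<close> and fails the bounds at
  finitely many other points only. Separating functions for these points repair this without
  changing the order at \<open>P\<close>; their poles are confined to \<open>Q\<close>, where
  nothing is demanded.\<close>

lemma prescribed_order:
  fixes E :: "('f \<Rightarrow> int) \<Rightarrow> int"
  assumes P: "P \<in> rational_points K" and Q: "Q \<in> closed_points K" and PQ: "P \<noteq> Q"
    and E: "finite {v. E v \<noteq> 0}"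
  obtains f where "f \<noteq> 0" "P f = E P" "\<And>v. v \<in> closed_points K \<Longrightarrow> v \<noteq> Q \<Longrightarrow> E v \<le> v f"
proof -
  have P': "P \<in> closed_points K" using P by (simp add: rational_points_def)
  obtain \<tau> where \<tau>: "\<tau> \<noteq> 0" "P \<tau> = 1" using val_uniformizer[OF P'] by blast
  define g where "g = \<tau> powi E P"
  have g: "g \<noteq> 0" "P g = E P" using \<tau> by (auto simp: g_def val_powi[OF P'])
  define T where "T = ({v \<in> closed_points K. v g < 0} \<union> ({v. E v \<noteq> 0} \<inter> closed_points K)) - {P, Q}"
  have T: "finite T" using finite_poles[of g] E by (auto simp: T_def)
  have "\<exists>t. t \<noteq> 0 \<and> P t = 0 \<and> 0 < v t \<and> (\<forall>w\<in>closed_points K. w \<noteq> Q \<longrightarrow> vge w 0 t)" if "v \<in> T" for v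
    using that by (intro separating_function[OF P Q PQ]) (auto simp: T_def)
  then obtain t where t: "\<And>v. v \<in> T \<Longrightarrow> t v \<noteq> 0" "\<And>v. v \<in> T \<Longrightarrow> P (t v) = 0"
    "\<And>v. v \<in> T \<Longrightarrow> 0 < v (t v)" "\<And>v w. v \<in> T \<Longrightarrow> w \<in> closed_points K \<Longrightarrow> w \<noteq> Q \<Longrightarrow> 0 \<le> w (t v)"
    unfolding vge_def by metis
  \<comment> \<open>At every point of \<open>T\<close> this exceeds the pole order of
    \<open>g\<close> and the required order together.\<close>
  define m where "m = nat (\<Sum>v\<in>T. \<bar>v g\<bar> + \<bar>E v\<bar>)"
  have m: "\<bar>v g\<bar> + \<bar>E v\<bar> \<le> int m" if "v \<in> T" for v
  proof -
    have "\<bar>v g\<bar> + \<bar>E v\<bar> \<le> (\<Sum>v\<in>T. \<bar>v g\<bar> + \<bar>E v\<bar>)"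
      by (rule member_le_sum[OF that _ T]) simp
    then show ?thesis unfolding m_def by linarith
  qed
  define s where "s = (\<Prod>v\<in>T. t v)"
  have s0: "s \<noteq> 0" using t(1) T by (simp add: s_def)
  have vs: "w s = (\<Sum>v\<in>T. w (t v))" if w: "w \<in> closed_points K" for w
    unfolding s_def using T t(1)
  proof (induction T rule: finite_induct)
    case empty
    then show ?case using val_one[OF w] by simp
  next
    case (insert v T)
    then show ?case using val_mult[OF w, of "t v" "prod t T"] by auto
  qed
  define f where "f = g * s ^ m"
  have vf: "w f = w g + int m * w s" if "w \<in> closed_points K" for w
    using g s0 val_mult[OF that, of g "s ^ m"] by (simp add: f_def val_power[OF that])
  have s_nonneg: "0 \<le> w s" if "w \<in> closed_points K" "w \<noteq> Q" for w
    unfolding vs[OF that(1)] using t(4) that by (intro sum_nonneg) auto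
  have PT: "P s = 0" unfolding vs[OF P'] using t(2) by simp
  show ?thesis
  proof (rule that[of f])
    show "f \<noteq> 0" using g s0 by (simp add: f_def)
    show Pf: "P f = E P" using vf[OF P'] PT g by simp
    fix v assume v: "v \<in> closed_points K" "v \<noteq> Q"
    consider "v = P" | "v \<in> T" | "v \<noteq> P" "v \<notin> T" by blast
    then show "E v \<le> v f"
    proof cases
      case 2
      have "v (t v) \<le> v s" unfolding vs[OF v(1)] using t(4) v 2 T by (intro member_le_sum) auto
      then have "1 \<le> v s" using t(3)[OF 2] by simp
      then have "int m * 1 \<le> int m * v s" by (intro mult_left_mono) auto
      then show ?thesis using vf[OF v(1)] m[OF 2] by linarith
    next
      case 3
      then have "0 \<le> v g" "E v = 0" using v by (auto simp: T_def)
      then show ?thesis using vf[OF v(1)] s_nonneg[OF v] by simp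
    qed (use Pf in simp)
  qed
qed

text \<open>By \<open>pole_exists\<close> such a function is constant, and constants have order 0 at
  \<open>Q\<close>.\<close>

lemma regular_vanishing_zero:
  assumes Q: "Q \<in> closed_points K" and "\<And>v. v \<in> closed_points K \<Longrightarrow> vge v 0 f" and "vge Q 1 f"
  shows "f = 0"
proof (rule ccontr)
  assume "f \<noteq> 0"
  then have "Q f \<noteq> 0" using assms(3) by (simp add: vge_def)
  then obtain v where "v \<in> closed_points K" "v f < 0"
    using pole_exists val_nonzero_not_const[OF Q] by blast
  then show False using assms(2)[of v] \<open>f \<noteq> 0\<close> by (simp add: vge_def)
qed

end

section \<open>Divisors on the curve\<close>

lemma ring_of_type_algebra_simps:
  shows "carrier (ring_of_type_algebra :: 'a::field ring) = UNIV"
    and "x \<otimes>\<^bsub>ring_of_type_algebra\<^esub> y = x * (y :: 'a)"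
    and "x \<oplus>\<^bsub>ring_of_type_algebra\<^esub> y = x + (y :: 'a)"
    and "\<one>\<^bsub>ring_of_type_algebra\<^esub> = (1 :: 'a)"
    and "\<zero>\<^bsub>ring_of_type_algebra\<^esub> = (0 :: 'a)"
    and "\<ominus>\<^bsub>ring_of_type_algebra\<^esub> x = - (x :: 'a)"
    and "x \<noteq> 0 \<Longrightarrow> inv\<^bsub>ring_of_type_algebra\<^esub> x = inverse (x :: 'a)"
    and "x [^]\<^bsub>ring_of_type_algebra\<^esub> (n::nat) = (x :: 'a) ^ n"
proof -
  define F where "F = (ring_of_type_algebra :: 'a ring)"
  interpret F: field F unfolding F_def by (rule field_from_type_algebra)
  have F: "carrier F = UNIV" "\<And>x y. x \<otimes>\<^bsub>F\<^esub> y = x * y" "\<And>x y. x \<oplus>\<^bsub>F\<^esub> y = x + y"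
    "\<one>\<^bsub>F\<^esub> = 1" "\<zero>\<^bsub>F\<^esub> = 0"
    by (simp_all add: F_def ring_of_type_algebra_def)
  show "carrier (ring_of_type_algebra :: 'a ring) = UNIV"
    "x \<otimes>\<^bsub>ring_of_type_algebra\<^esub> y = x * y" "x \<oplus>\<^bsub>ring_of_type_algebra\<^esub> y = x + y"
    "\<one>\<^bsub>ring_of_type_algebra\<^esub> = (1 :: 'a)" "\<zero>\<^bsub>ring_of_type_algebra\<^esub> = (0 :: 'a)"
    using F by (simp_all add: F_def)
  show "\<ominus>\<^bsub>ring_of_type_algebra\<^esub> x = - x"
    using F.minus_equality[of "- x" x] F by (simp add: F_def)
  show "inv\<^bsub>ring_of_type_algebra\<^esub> x = inverse x" if "x \<noteq> 0"
    using F.comm_inv_char[of x "inverse x"] F that by (simp add: F_def)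
  show "x [^]\<^bsub>ring_of_type_algebra\<^esub> n = x ^ n"
    using F by (induction n) (simp_all add: F_def[symmetric] mult.commute)
qed

context constant_field
begin

text \<open>Elements of \<open>K(x)\<close> are fractions of polynomials in \<open>x\<close>, by
  induction on their generation; for an inverse, the numerator \<open>b * h\<close> takes over as
  denominator.\<close>

lemma generate_field_fraction:
  assumes "k \<in> generate_field ring_of_type_algebra (insert x K)"
  shows "\<exists>b\<in>adjoin x. b \<noteq> 0 \<and> b * k \<in> adjoin x"
  using assms
proof (induction rule: generate_field.induct)
  case one
  then show ?case by (auto simp: ring_of_type_algebra_simps intro!: bexI[of _ 1])
next
  case (incl h)
  then show ?case by (auto intro!: bexI[of _ 1])
next
  case (a_inv h)
  then show ?case by (auto simp: ring_of_type_algebra_simps)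
next
  case (m_inv h)
  then obtain b where b: "b \<in> adjoin x" "b \<noteq> 0" "b * h \<in> adjoin x" by blast
  have h: "h \<noteq> 0" using m_inv by (simp add: ring_of_type_algebra_simps)
  have eq: "(b * h) * inv\<^bsub>ring_of_type_algebra\<^esub> h = b"
    using h by (simp add: ring_of_type_algebra_simps)
  show ?case
  proof (intro bexI[of _ "b * h"] conjI)
    show "b * h * inv\<^bsub>ring_of_type_algebra\<^esub> h \<in> adjoin x" unfolding eq by (rule b)
  qed (use b h in auto)
next
  case (eng_add h1 h2)
  then obtain b1 b2 where b: "b1 \<in> adjoin x" "b1 \<noteq> 0" "b1 * h1 \<in> adjoin x"
    "b2 \<in> adjoin x" "b2 \<noteq> 0" "b2 * h2 \<in> adjoin x" by blast
  have eq: "(b1 * b2) * (h1 \<oplus>\<^bsub>ring_of_type_algebra\<^esub> h2) = b2 * (b1 * h1) + b1 * (b2 * h2)"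
    by (simp add: ring_of_type_algebra_simps algebra_simps)
  show ?case
  proof (intro bexI[of _ "b1 * b2"] conjI)
    show "b1 * b2 * (h1 \<oplus>\<^bsub>ring_of_type_algebra\<^esub> h2) \<in> adjoin x"
      unfolding eq using b by blast
  qed (use b in auto)
next
  case (eng_mult h1 h2)
  then obtain b1 b2 where b: "b1 \<in> adjoin x" "b1 \<noteq> 0" "b1 * h1 \<in> adjoin x"
    "b2 \<in> adjoin x" "b2 \<noteq> 0" "b2 * h2 \<in> adjoin x" by blast
  have eq: "(b1 * b2) * (h1 \<otimes>\<^bsub>ring_of_type_algebra\<^esub> h2) = (b1 * h1) * (b2 * h2)"
    by (simp add: ring_of_type_algebra_simps algebra_simps)
  show ?case
  proof (intro bexI[of _ "b1 * b2"] conjI)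
    show "b1 * b2 * (h1 \<otimes>\<^bsub>ring_of_type_algebra\<^esub> h2) \<in> adjoin x"
      unfolding eq using b by blast
  qed (use b in auto)
qed

end

text \<open>Transcendence is read off from the evaluation of coefficient lists; finiteness comes
  from a basis over \<open>K(x)\<close>, once the coordinates have a common denominator.\<close>

lemma curve_function_field:
  fixes K :: "'f::field set"
  assumes "curve_over_finite_field K"
  shows "function_field K"
proof -
  define F where "F = (ring_of_type_algebra :: 'f ring)"
  interpret F: field F unfolding F_def by (rule field_from_type_algebra)
  note F = ring_of_type_algebra_simps[where 'a = 'f, folded F_def]
  have sub: "subfield K F" and fin: "finite K"
    and ext: "\<exists>x. F.finite_dimension (generate_field F (insert x K)) UNIV"
    and alg: "\<And>x. x \<notin> K \<Longrightarrow> F.transcendental K x"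
    using assms unfolding curve_over_finite_field_def Let_def F_def[symmetric] by blast+
  note K = subringE[OF subfieldE(1)[OF sub], unfolded F]
  interpret constant_field K
  proof
    show "inverse a \<in> K" if "a \<in> K" for a
      using F.subfield_m_inv(1)[OF sub, of a] that F by (cases "a = 0") auto
  qed (use K fin in auto)
  \<comment> \<open>Polynomial lists carry the leading coefficient first, hence the
    reversal.\<close>
  have eval: "F.eval (rev (map c [0..<n])) z = (\<Sum>i<n. c i * z ^ i)" for c z n
    by (induction n) (simp_all add: F add.commute)
  have trans: "c i = 0"
    if z: "z \<notin> K" and c: "\<And>i. c i \<in> K" "(\<Sum>i\<le>n. c i * z ^ i) = 0" and i: "i \<le> n" for z c n i
  proof (rule ccontr)
    assume "c i \<noteq> 0"
    define J where "J = {j. j \<le> n \<and> c j \<noteq> 0}"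
    have J: "finite J" "J \<noteq> {}" using i \<open>c i \<noteq> 0\<close> by (auto simp: J_def)
    define l where "l = Max J"
    have l: "l \<le> n" "c l \<noteq> 0" using Max_in[OF J] by (auto simp: l_def J_def)
    have above: "c j = 0" if "l < j" "j \<le> n" for j
      using Max_ge[OF J(1), of j] that unfolding l_def[symmetric] by (auto simp: J_def)
    \<comment> \<open>The list is cut at the last nonzero coefficient because a nonempty polynomial
      list needs a nonzero head.\<close>
    define p where "p = rev (map c [0..<Suc l])"
    have "F.eval p z = (\<Sum>i<Suc l. c i * z ^ i)" unfolding p_def by (rule eval)
    also have "\<dots> = (\<Sum>i\<le>n. c i * z ^ i)"
      using l(1) above by (intro sum.mono_neutral_left) (auto simp: not_less)
    finally have "F.eval p z = \<zero>\<^bsub>F\<^esub>" using c(2) F by simp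
    moreover have "p \<in> carrier (K[X]\<^bsub>F\<^esub>)"
      unfolding univ_poly_carrier[symmetric] polynomial_def using c(1) l(2) F by (auto simp: p_def)
    ultimately have "p = []"
      using F.eval_transcendental[of K z p] alg[OF z] by (simp add: over_def)
    then show False by (simp add: p_def)
  qed
  obtain x where "F.finite_dimension (generate_field F (insert x K)) UNIV" using ext by blast
  then obtain n where dim: "F.dimension n (generate_field F (insert x K)) UNIV" by blast
  have sub': "subfield (generate_field F (insert x K)) F"
    by (rule F.generate_field_is_subfield) (simp add: F)
  obtain us where us: "F.Span (generate_field F (insert x K)) us = UNIV"
    using F.exists_base[OF sub' dim] by blast
  have comb: "F.combine ks us = (\<Sum>k<length us. ks ! k * us ! k)" if "length ks = length us" for ks us
    using that
  proof (induction ks us rule: list_induct2)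
    case (Cons k ks u us)
    then show ?case by (simp add: F sum.lessThan_Suc_shift del: sum.lessThan_Suc)
  qed (simp add: F)
  have "\<exists>d\<in>adjoin x. \<exists>a. d \<noteq> 0 \<and> (\<forall>k. a k \<in> adjoin x) \<and> d * f = (\<Sum>k<length us. a k * us ! k)" for f
  proof -
    have "f \<in> F.Span (generate_field F (insert x K)) us" using us by simp
    then obtain ks where ks: "f = F.combine ks us" "length ks = length us" "set ks \<subseteq> generate_field F (insert x K)"
      using F.Span_eq_combine_set_length_version[OF sub', of us] F by auto
    have "\<exists>b\<in>adjoin x. b \<noteq> 0 \<and> b * ks ! k \<in> adjoin x" if "k < length us" for k
      using generate_field_fraction[of "ks ! k" x] ks(2,3) that unfolding F_def
      by (metis nth_mem subsetD)
    then obtain b where b: "\<And>k. k < length us \<Longrightarrow> b k \<in> adjoin x" "\<And>k. k < length us \<Longrightarrow> b k \<noteq> 0"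
      "\<And>k. k < length us \<Longrightarrow> b k * ks ! k \<in> adjoin x" by metis
    \<comment> \<open>A common denominator of the coordinates; the \<open>a k\<close> are the
      resulting numerators.\<close>
    define d where "d = (\<Prod>k<length us. b k)"
    define a where "a k = (if k < length us then (\<Prod>i\<in>{..<length us} - {k}. b i) * (b k * ks ! k) else 0)" for k
    have "d * ks ! k = a k" if "k < length us" for k
      using that prod.remove[of "{..<length us}" k b] by (simp add: d_def a_def mult_ac)
    then have "d * f = (\<Sum>k<length us. a k * us ! k)"
      unfolding ks(1) comb[OF ks(2)] sum_distrib_left by (intro sum.cong) (auto simp flip: mult.assoc)
    moreover have "d \<in> adjoin x" unfolding d_def using b(1) by (intro adjoin_prod) auto
    moreover have "d \<noteq> 0" unfolding d_def using b(2) by simp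
    moreover have "a k \<in> adjoin x" for k
    proof (cases "k < length us")
      case True
      have "(\<Prod>i\<in>{..<length us} - {k}. b i) \<in> adjoin x" using b(1) by (intro adjoin_prod) auto
      from adjoin_mult[OF this b(3)[OF True]] show ?thesis using True by (simp add: a_def)
    qed (auto simp: a_def)
    ultimately show ?thesis by blast
  qed
  then show ?thesis
    by (unfold_locales) (use trans in blast)+
qed

section \<open>Shifting a divisor by multiples of \<open>Q\<close>\<close>

context
  fixes K :: "'f::field set" and P Q :: "'f \<Rightarrow> int"
  assumes curve: "curve_over_finite_field K"
    and P: "P \<in> rational_points K" and Q: "Q \<in> rational_points K" and PQ: "P \<noteq> Q"
begin

interpretation function_field K
  by (rule curve_function_field[OF curve])

lemma closed_PQ: "P \<in> closed_points K" "Q \<in> closed_points K"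
  using P Q by (auto simp: rational_points_def)

lemma shift_in_divisors: "E \<in> divisors K \<Longrightarrow> E + frag_cmul k (frag_of Q) \<in> divisors K"
proof -
  assume "E \<in> divisors K"
  moreover have "Poly_Mapping.keys (frag_cmul k (frag_of Q)) \<subseteq> closed_points K"
    using closed_PQ(2) keys_cmul[of k "frag_of Q"] by auto
  ultimately show ?thesis
    unfolding divisors_def carrier_free_Abelian_group_iff
    using Poly_Mapping.keys_add[of E "frag_cmul k (frag_of Q)"] by blast
qed

text \<open>Passing from \<open>E\<close> to \<open>E - P\<close> tightens only the condition at
  \<open>P\<close>, so the spaces differ exactly if some function attains the bound there.\<close>

lemma L_space_neq_iff:
  "L_space K E \<noteq> L_space K (E - frag_of P) \<longleftrightarrow>
     (\<exists>f. f \<noteq> 0 \<and> P f = - Poly_Mapping.lookup E P \<and>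
          (\<forall>v\<in>closed_points K. - Poly_Mapping.lookup E v \<le> v f))"
proof
  assume "L_space K E \<noteq> L_space K (E - frag_of P)"
  moreover have "L_space K (E - frag_of P) \<subseteq> L_space K E"
    by (fastforce simp: L_space_def lookup_minus split: if_splits)
  ultimately obtain f where "f \<in> L_space K E" "f \<notin> L_space K (E - frag_of P)" by blast
  then have f: "f \<noteq> 0" "\<And>v. v \<in> closed_points K \<Longrightarrow> 0 \<le> v f + Poly_Mapping.lookup E v"
    and "\<exists>v\<in>closed_points K. \<not> 0 \<le> v f + Poly_Mapping.lookup (E - frag_of P) v"
    by (auto simp: L_space_def)
  then obtain v where v: "v \<in> closed_points K" "v f + Poly_Mapping.lookup (E - frag_of P) v < 0"
    by force
  then have "v = P" using f(2)[OF v(1)] by (auto simp: lookup_minus split: if_splits)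
  then have "P f = - Poly_Mapping.lookup E P" using v f(2)[OF v(1)] by (simp add: lookup_minus)
  then show "\<exists>f. f \<noteq> 0 \<and> P f = - Poly_Mapping.lookup E P \<and>
          (\<forall>v\<in>closed_points K. - Poly_Mapping.lookup E v \<le> v f)"
    using f by (intro exI[of _ f]) force
next
  assume "\<exists>f. f \<noteq> 0 \<and> P f = - Poly_Mapping.lookup E P \<and>
          (\<forall>v\<in>closed_points K. - Poly_Mapping.lookup E v \<le> v f)"
  then obtain f where f: "f \<noteq> 0" "P f = - Poly_Mapping.lookup E P"
    "\<And>v. v \<in> closed_points K \<Longrightarrow> - Poly_Mapping.lookup E v \<le> v f" by blast
  have "0 \<le> v f + Poly_Mapping.lookup E v" if "v \<in> closed_points K" for v
    using f(3)[OF that] by linarith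
  then have "f \<in> L_space K E" using f(1) by (simp add: L_space_def)
  moreover have "\<not> 0 \<le> P f + Poly_Mapping.lookup (E - frag_of P) P" using f(2) by (simp add: lookup_minus)
  then have "f \<notin> L_space K (E - frag_of P)"
    unfolding L_space_def using f(1) closed_PQ(1) by blast
  ultimately show "L_space K E \<noteq> L_space K (E - frag_of P)" by blast
qed

text \<open>\<open>LEAST\<close> on the integers is meaningful only if a least element exists. One
  function of prescribed order shows that the set of admissible \<open>k\<close> is nonempty,
  another that it is bounded below.\<close>

lemma Gamma_threshold:
  assumes E: "E \<in> divisors K"
  obtains m where "\<And>k. E + frag_cmul k (frag_of Q) \<in> Gamma_set K P \<longleftrightarrow> m \<le> k"
    "min_shift K Q P E = E + frag_cmul m (frag_of Q)"
proof -
  define e where "e = Poly_Mapping.lookup E"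
  \<comment> \<open>The shift by \<open>k\<close> relaxes only the condition at
    \<open>Q\<close>.\<close>
  define G where "G k \<longleftrightarrow> (\<exists>f. f \<noteq> 0 \<and> P f = - e P \<and> - e Q - k \<le> Q f \<and>
      (\<forall>v\<in>closed_points K. v \<noteq> Q \<longrightarrow> - e v \<le> v f))" for k
  have G_iff: "L_space K (E + frag_cmul k (frag_of Q)) \<noteq> L_space K (E + frag_cmul k (frag_of Q) - frag_of P)
      \<longleftrightarrow> G k" for k
    unfolding L_space_neq_iff G_def using PQ closed_PQ(2)
    by (intro ex_cong1) (auto simp: lookup_add e_def split: if_splits)
  have Gamma_iff: "E + frag_cmul k (frag_of Q) \<in> Gamma_set K P \<longleftrightarrow> G k" for k
    unfolding Gamma_set_def using shift_in_divisors[OF E] G_iff by simp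
  have fin: "finite {v. e v \<noteq> 0}" by (simp add: e_def)
  obtain f0 where f0: "f0 \<noteq> 0" "P f0 = - e P" "\<And>v. v \<in> closed_points K \<Longrightarrow> v \<noteq> Q \<Longrightarrow> - e v \<le> v f0"
    using prescribed_order[OF P closed_PQ(2) PQ, of "\<lambda>v. - e v"] fin by auto
  have G0: "G (- e Q - Q f0)" unfolding G_def using f0 by (intro exI[of _ f0]) auto
  \<comment> \<open>For \<open>f\<close> witnessing \<open>G k\<close>, the product
    \<open>f * t\<close> is regular away from \<open>Q\<close> and has order at least
    \<open>b - k\<close> at \<open>Q\<close>. If \<open>k < b\<close> it vanishes at
    \<open>Q\<close> and would be zero.\<close>
  obtain t where t: "t \<noteq> 0" "P t = e P" "\<And>v. v \<in> closed_points K \<Longrightarrow> v \<noteq> Q \<Longrightarrow> e v \<le> v t"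
    using prescribed_order[OF P closed_PQ(2) PQ fin] by blast
  define b where "b = Q t - e Q"
  have lower: "b \<le> k" if "G k" for k
  proof (rule ccontr)
    assume k: "\<not> b \<le> k"
    obtain f where f: "f \<noteq> 0" "- e Q - k \<le> Q f" "\<And>v. v \<in> closed_points K \<Longrightarrow> v \<noteq> Q \<Longrightarrow> - e v \<le> v f"
      using \<open>G k\<close> unfolding G_def by blast
    have Q1: "vge Q 1 (f * t)"
      using val_mult[OF closed_PQ(2) f(1) t(1)] f(2) k by (simp add: vge_def b_def)
    have "vge v 0 (f * t)" if v: "v \<in> closed_points K" for v
    proof (cases "v = Q")
      case True
      then show ?thesis using vge_mono[OF Q1, of 0] by simp
    next
      case False
      then show ?thesis
        using val_mult[OF v f(1) t(1)] f(3)[OF v False] t(3)[OF v False] by (simp add: vge_def)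
    qed
    then have "f * t = 0" using regular_vanishing_zero[OF closed_PQ(2) _ Q1] by blast
    then show False using f(1) t(1) by simp
  qed
  have mono: "G l" if "G k" "k \<le> l" for k l
  proof -
    obtain f where "f \<noteq> 0" "P f = - e P" "- e Q - k \<le> Q f" "\<forall>v\<in>closed_points K. v \<noteq> Q \<longrightarrow> - e v \<le> v f"
      using \<open>G k\<close> unfolding G_def by blast
    then show ?thesis unfolding G_def using \<open>k \<le> l\<close> by (intro exI[of _ f]) auto
  qed
  \<comment> \<open>Counting from the lower bound moves the minimum to the natural numbers, where it
    exists.\<close>
  define n where "n = (LEAST n. G (b + int n))"
  have "b + int (nat (- e Q - Q f0 - b)) = - e Q - Q f0" using lower[OF G0] by simp
  then have "G (b + int (nat (- e Q - Q f0 - b)))" using G0 by metis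
  then have n: "G (b + int n)" unfolding n_def by (rule LeastI)
  have least: "b + int n \<le> k" if "G k" for k
  proof -
    have "k = b + int (nat (k - b))" using lower[OF that] by simp
    then have "n \<le> nat (k - b)" unfolding n_def using that by (metis Least_le)
    then show ?thesis using lower[OF that] by linarith
  qed
  have "(LEAST k. G k) = b + int n" using n least by (rule Least_equality)
  then have "min_shift K Q P E = E + frag_cmul (b + int n) (frag_of Q)"
    unfolding min_shift_def G_iff by simp
  moreover have "E + frag_cmul k (frag_of Q) \<in> Gamma_set K P \<longleftrightarrow> b + int n \<le> k" for k
    unfolding Gamma_iff using n least mono by blast
  ultimately show ?thesis using that by blast
qed

end

theorem theorem8p7:
  fixes K :: "'f::field set" and P Q :: "'f \<Rightarrow> int" and A C :: "'f divisor"
  assumes "curve_over_finite_field K"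
    and "P \<in> rational_points K" and "Q \<in> rational_points K" and "P \<noteq> Q"
    and "A \<in> divisors K" and "C \<in> divisors K"
  shows "(A \<in> Delta_set K P (C + frag_of Q) \<longleftrightarrow>
            min_shift K Q P A \<le>\<^sub>D A \<and> A \<le>\<^sub>D min_shift K Q P (A - C) + C) \<and>
         (min_shift K Q P A = A \<and> A \<le>\<^sub>D min_shift K Q P (A - C) + C \<longleftrightarrow>
            A \<in> Delta_set K P (C + frag_of Q) \<and> A - frag_of Q \<notin> Delta_set K P (C + frag_of Q)) \<and>
         (min_shift K Q P A \<le>\<^sub>D A \<and> A = min_shift K Q P (A - C) + C \<longleftrightarrow>
            A \<in> Delta_set K P (C + frag_of Q) \<and> A + frag_of Q \<notin> Delta_set K P (C + frag_of Q)) \<and>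
         (A \<in> Delta_set K P (C + frag_of Q) \<and> A + frag_of Q \<notin> Delta_set K P (C + frag_of Q) \<longleftrightarrow>
            A \<in> Delta_set K P (C + frag_of Q) \<and> A \<notin> Delta_set K P C)"
proof -
  let ?q = "\<lambda>k. frag_cmul k (frag_of Q)"
  have AC: "A - C \<in> divisors K"
    using assms(5,6) keys_diff[of A C] by (auto simp: divisors_def)
  \<comment> \<open>The thresholds \<open>m\<close> of \<open>A\<close> and \<open>l\<close> of
    \<open>A - C\<close> decide every membership and every comparison below.\<close>
  obtain m where m: "\<And>k. A + ?q k \<in> Gamma_set K P \<longleftrightarrow> m \<le> k" "min_shift K Q P A = A + ?q m"
    using Gamma_threshold[OF assms(1-4) assms(5)] by blast
  obtain l where l: "\<And>k. A - C + ?q k \<in> Gamma_set K P \<longleftrightarrow> l \<le> k" "min_shift K Q P (A - C) = A - C + ?q l"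
    using Gamma_threshold[OF assms(1-4) AC] by blast
  have le1: "A + ?q m \<le>\<^sub>D A \<longleftrightarrow> m \<le> 0"
    by (auto simp: div_le_def lookup_add split: if_splits)
  have le2: "A \<le>\<^sub>D A - C + ?q l + C \<longleftrightarrow> 0 \<le> l"
    by (auto simp: div_le_def lookup_add lookup_minus split: if_splits)
  have eq0: "?q k = 0 \<longleftrightarrow> k = 0" for k
    by (metis frag_cmul_zero lookup_frag_cmul lookup_frag_of lookup_zero mult_1_right)
  have eq1: "A + ?q m = A \<longleftrightarrow> m = 0" using eq0 by simp
  have eq2: "A = A - C + ?q l + C \<longleftrightarrow> l = 0"
    using eq0[of l] by (simp add: algebra_simps)
  \<comment> \<open>All divisors in question are shifts of \<open>A\<close> or \<open>A - C\<close>
    by multiples of \<open>Q\<close>. For \<open>C + Q\<close> the shift of \<open>A - C\<close> is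
    \<open>- 1\<close>, so exclusion from \<open>Gamma_set\<close> reads \<open>- 1 < l\<close>,
    which is \<open>0 \<le> l\<close>.\<close>
  have s: "A - (C + frag_of Q) = A - C + ?q (- 1)" "A - frag_of Q = A + ?q (- 1)"
    "A + frag_of Q = A + ?q 1" "A - frag_of Q - (C + frag_of Q) = A - C + ?q (- 2)"
    "A + frag_of Q - (C + frag_of Q) = A - C + ?q 0"
    by (auto intro!: poly_mapping_eqI simp: lookup_add lookup_minus)
  have D0: "A \<in> Delta_set K P (C + frag_of Q) \<longleftrightarrow> m \<le> 0 \<and> 0 \<le> l"
    using m(1)[of 0] l(1)[of "- 1"] by (auto simp: Delta_set_def s(1))
  have D1: "A - frag_of Q \<in> Delta_set K P (C + frag_of Q) \<longleftrightarrow> m \<le> - 1 \<and> - 1 \<le> l"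
    unfolding Delta_set_def mem_Collect_eq s(4) unfolding s(2) m(1) l(1) by auto
  have D2: "A + frag_of Q \<in> Delta_set K P (C + frag_of Q) \<longleftrightarrow> m \<le> 1 \<and> 1 \<le> l"
    unfolding Delta_set_def mem_Collect_eq s(5) unfolding s(3) m(1) l(1) by auto
  have D3: "A \<in> Delta_set K P C \<longleftrightarrow> m \<le> 0 \<and> 1 \<le> l"
    unfolding Delta_set_def mem_Collect_eq using m(1)[of 0] l(1)[of 0] by auto
  show ?thesis
    unfolding m(2) l(2) D0 D1 D2 D3 le1 le2 eq1 eq2 by auto
qed

end
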